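(* For $N\ge1$ let $\mu_N$ be the set of $N$-th roots of unity in $\mathbb{C}$, and define \[ \mathcal{C}^{\star}=\bigcup_{N\geq1}\left\{\sum_{n_1\geq\cdots\geq n_r\geq 1}\frac{z^{n_1-1}}{n_1^{k_1}\cdots n_r^{k_r}}\ \bigg|\ z\in\mu_N,\ r\geq 1,\ k_1,\ldots,k_r\geq1,\ (k_1,z)\neq(1,1)\right\}, \] where $r,k_1,\ldots,k_r$ are integers. Let $\mathcal{H}=\{w\in\mathbb{C}:\mathrm{Re}\,w\ge\frac12\}$ and $\mathcal{H}^{o}=\{w\in\mathbb{C}:\mathrm{Re}\,w>\frac12\}$. Then $\mathcal{C}^{\star}$ is a countable dense subset of $\mathcal{H}^{o}$. Consequently, \[ (\mathcal{C}^{\star})^{(n)}=\mathcal{H}\qquad\text{for all } n\ge1. \]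
   Context: The sums are taken by partial sums with respect to the outer variable $n_1$ (absolutely convergent if $k_1\ge2$; convergent for $|z|=1$, $z\ne1$ if $k_1=1$). For $E\subseteq\mathbb{C}$, $E'$ denotes the derived set (set of accumulation points of $E$ in $\mathbb{C}$), $E^{(0)}=E$, and $E^{(n+1)}=(E^{(n)})'$. *)

theory Defs
  imports "HOL-Analysis.Analysis"
begin

definition roots_of_unity :: "nat \<Rightarrow> complex set" where
  "roots_of_unity N = {z. z ^ N = 1}"

text \<open>
  Tuples \<open>n_1 \<ge> \<dots> \<ge> n_r \<ge> 1\<close> are lists of length \<open>r\<close>.  Fixing the outer variable
  \<open>n_1 = n\<close> leaves a finite set of tuples when \<open>r \<ge> 1\<close>.
\<close>

definition star_tuples :: "nat \<Rightarrow> nat \<Rightarrow> nat list set" where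
  "star_tuples r n =
     {ns. length ns = r \<and> sorted_wrt (\<ge>) ns \<and> (\<forall>m\<in>set ns. 1 \<le> m) \<and> hd ns = n}"

text \<open>
  The multiple sum is taken by partial sums in \<open>n_1\<close>; since \<open>n_1\<close> starts at \<open>1\<close>, the series
  index \<open>m\<close> below corresponds to \<open>n_1 = Suc m\<close>.
\<close>

definition star_value :: "complex \<Rightarrow> nat list \<Rightarrow> complex" where
  "star_value z ks =
     (\<Sum>m. \<Sum>ns\<in>star_tuples (length ks) (Suc m).
        z ^ (hd ns - 1) / (\<Prod>i<length ks. of_nat (ns ! i) ^ (ks ! i)))"

definition C_star :: "complex set" where
  "C_star = (\<Union>N\<in>{1..}. {star_value z ks | z ks.
     z \<in> roots_of_unity N \<and> length ks \<ge> 1 \<and> (\<forall>k\<in>set ks. 1 \<le> k) \<and> (hd ks, z) \<noteq> (1, 1)})"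

definition closed_half_plane :: "complex set" where
  "closed_half_plane = {w. Re w \<ge> 1/2}"

definition open_half_plane :: "complex set" where
  "open_half_plane = {w. Re w > 1/2}"

definition iterated_derived_set :: "nat \<Rightarrow> complex set \<Rightarrow> complex set" where
  "iterated_derived_set n E = (((derived_set_of) euclidean) ^^ n) E"

end

theory Submission
  imports Defs
begin

text \<open>
  Let \<open>A\<close> and \<open>B\<close> be the random maps of \<open>[0, 1]\<close> sending \<open>x\<close> to a uniformly distributed point of the segment
  from \<open>x\<close> to \<open>0\<close> and to \<open>1\<close>, respectively. A word in these letters, applied to \<open>0\<close>, gives a random
  variable \<open>X\<close>, and the star sum of index \<open>k_1, \<dots>, k_r\<close> at \<open>z\<close> is the expectation of \<open>1 / (1 - z X)\<close>
  for the word \<open>A^(k_1 - 1) B \<dots> A^(k_r - 1) B\<close>, since the moments of \<open>X\<close> are the coefficients of the sum.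
  Hence all values have real part above \<open>1/2\<close>.

  For density, read words of length \<open>n\<close> as dyadic numbers in \<open>[0, 1]\<close>. Neighbouring words have expectations
  of an \<open>L\<close>-Lipschitz function within \<open>L / 2 ^ n\<close>, so for each \<open>z\<close> they form a chain from \<open>1\<close> to
  \<open>1 / (1 - z)\<close>. If all values avoid a neighbourhood of \<open>w\<close>, then a continuous logarithm of \<open>1 - w\<close> (a
  constant) can be continued along the chain to one of \<open>1 / (1 - z) - w\<close> for \<open>z\<close> on the boundary of the unit
  disc with a small neighbourhood of \<open>1\<close> removed. This is impossible, as that boundary winds once around
  \<open>1 - 1 / w\<close>. On the small arc near \<open>1\<close> the values avoid a non-real \<open>w\<close> because they are either large
  or almost real.
\<close>

section \<open>Averages along words\<close>

text \<open>In a word, \<open>False\<close> is the letter \<open>A\<close> and \<open>True\<close> the letter \<open>B\<close>; the head is applied last.\<close>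

definition seg_mean :: "bool \<Rightarrow> (real \<Rightarrow> complex) \<Rightarrow> real \<Rightarrow> complex" where
  "seg_mean b f x = integral {0..1} (\<lambda>t. f ((1 - t) * x + t * of_bool b))"

text \<open>The expectation of \<open>f\<close> at the random point of the word. Each letter acts on
  the test function as a conditional expectation given the letters applied before it, so the
  recursion stays within ordinary integrals over \<open>{0..1}\<close>.\<close>

primrec word_mean :: "bool list \<Rightarrow> (real \<Rightarrow> complex) \<Rightarrow> complex" where
  "word_mean [] f = f 0"
| "word_mean (b # v) f = word_mean v (seg_mean b f)"

lemma seg_in_unit:
  assumes "x \<in> {0..1::real}" "t \<in> {0..1}"
  shows "(1 - t) * x + t * of_bool b \<in> {0..1}"
proof -
  have "(1 - t) * x \<le> 1 - t" "0 \<le> (1 - t) * x"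
    using assms by (auto intro: mult_left_le)
  then show ?thesis using assms by (cases b) auto
qed

lemma continuous_on_seg:
  assumes "continuous_on {0..1::real} f" "x \<in> {0..1}"
  shows "continuous_on {0..1} (\<lambda>t. f ((1 - t) * x + t * of_bool b))"
proof (rule continuous_on_compose2[OF assms(1)])
  show "continuous_on {0..1} (\<lambda>t. (1 - t) * x + t * of_bool b)"
    by (intro continuous_intros)
  show "(\<lambda>t. (1 - t) * x + t * of_bool b) ` {0..1} \<subseteq> {0..1}"
    using seg_in_unit[OF assms(2)] by blast
qed

lemma integrable_seg:
  fixes f :: "real \<Rightarrow> 'a::banach"
  assumes "continuous_on {0..1::real} f" "x \<in> {0..1}"
  shows "(\<lambda>t. f ((1 - t) * x + t * of_bool b)) integrable_on {0..1}"
  by (rule integrable_continuous_real) (rule continuous_on_seg[OF assms])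

lemma seg_mean_cong:
  assumes "\<And>x. x \<in> {0..1} \<Longrightarrow> f x = g x" "x \<in> {0..1}"
  shows "seg_mean b f x = seg_mean b g x"
  unfolding seg_mean_def by (rule integral_cong) (use assms seg_in_unit in blast)

text \<open>Joint continuity in parameter and point is the form that reproduces itself under the
  recursion: a letter integrates a jointly continuous function over a compact interval.\<close>

lemma continuous_on_seg_mean_param:
  fixes f :: "'z::topological_space \<Rightarrow> real \<Rightarrow> complex"
  assumes "continuous_on (S \<times> {0..1}) (\<lambda>(z, x). f z x)"
  shows "continuous_on (S \<times> {0..1}) (\<lambda>(z, x). seg_mean b (f z) x)"
proof -
  have "continuous_on ((S \<times> {0..1::real}) \<times> cbox 0 (1::real))
          (\<lambda>(p, t). f (fst p) ((1 - t) * snd p + t * of_bool b))"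
  proof -
    have "continuous_on ((S \<times> {0..1::real}) \<times> cbox 0 (1::real))
          ((\<lambda>(z, x). f z x) \<circ> (\<lambda>q. (fst (fst q), (1 - snd q) * snd (fst q) + snd q * of_bool b)))"
      by (intro continuous_on_compose continuous_intros continuous_on_subset[OF assms])
        (auto intro!: seg_in_unit simp del: atLeastAtMost_iff split del: split_of_bool)
    then show ?thesis by (simp add: o_def case_prod_unfold)
  qed
  from integral_continuous_on_param[OF this]
  show ?thesis by (simp add: seg_mean_def case_prod_unfold)
qed

lemma continuous_on_seg_mean:
  assumes "continuous_on {0..1} f"
  shows "continuous_on {0..1} (seg_mean b f)"
proof -
  \<comment> \<open>A one-point parameter space makes this an instance of the parametrised
    statement.\<close>
  have "continuous_on ({0} \<times> {0..1}) (\<lambda>(z::real, x). f x)"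
    using continuous_on_compose2[OF assms continuous_on_snd[OF continuous_on_id], of "{0} \<times> {0..1}"]
    by (auto simp: case_prod_unfold)
  from continuous_on_seg_mean_param[OF this, of b]
  have "continuous_on {0..1} ((\<lambda>(z::real, x). seg_mean b f x) \<circ> (\<lambda>x. (0, x)))"
    by (intro continuous_on_compose continuous_intros) (auto elim!: continuous_on_subset)
  then show ?thesis by (simp add: o_def)
qed

lemma continuous_on_word_mean_param:
  fixes f :: "'z::topological_space \<Rightarrow> real \<Rightarrow> complex"
  assumes "continuous_on (S \<times> {0..1}) (\<lambda>(z, x). f z x)"
  shows "continuous_on S (\<lambda>z. word_mean v (f z))"
  using assms
proof (induction v arbitrary: f)
  case Nil
  have "continuous_on S ((\<lambda>(z, x). f z x) \<circ> (\<lambda>z. (z, 0)))"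
    by (intro continuous_on_compose continuous_intros) (auto intro: continuous_on_subset[OF Nil])
  then show ?case by (simp add: o_def)
next
  case (Cons b v)
  show ?case using Cons.IH[OF continuous_on_seg_mean_param[OF Cons.prems]] by simp
qed

lemma word_mean_cong:
  assumes "\<And>x. x \<in> {0..1} \<Longrightarrow> f x = g x"
  shows "word_mean v f = word_mean v g"
  using assms
proof (induction v arbitrary: f g)
  case (Cons b v)
  show ?case using Cons.IH[OF seg_mean_cong[OF Cons.prems]] by simp
qed simp

lemma seg_mean_add:
  assumes "continuous_on {0..1} f" "continuous_on {0..1} g" "x \<in> {0..1}"
  shows "seg_mean b (\<lambda>x. f x + g x) x = seg_mean b f x + seg_mean b g x"
  unfolding seg_mean_def by (intro integral_add integrable_seg assms)

lemma word_mean_add: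
  assumes "continuous_on {0..1} f" "continuous_on {0..1} g"
  shows "word_mean v (\<lambda>x. f x + g x) = word_mean v f + word_mean v g"
  using assms
proof (induction v arbitrary: f g)
  case (Cons b v)
  have "word_mean v (seg_mean b (\<lambda>x. f x + g x)) = word_mean v (\<lambda>x. seg_mean b f x + seg_mean b g x)"
    by (intro word_mean_cong seg_mean_add Cons.prems)
  then show ?case using Cons by (simp add: continuous_on_seg_mean)
qed simp

lemma seg_mean_cmult: "seg_mean b (\<lambda>x. c * f x) = (\<lambda>x. c * seg_mean b f x)"
  unfolding seg_mean_def by (simp add: fun_eq_iff)

lemma word_mean_cmult: "word_mean v (\<lambda>x. c * f x) = c * word_mean v f"
  by (induction v arbitrary: f) (simp_all add: seg_mean_cmult)

lemma seg_mean_const: "seg_mean b (\<lambda>x. c) = (\<lambda>x. c)"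
  unfolding seg_mean_def by simp

lemma word_mean_const [simp]: "word_mean v (\<lambda>x. c) = c"
  by (induction v) (simp_all add: seg_mean_const)

lemma word_mean_diff:
  assumes "continuous_on {0..1} f" "continuous_on {0..1} g"
  shows "word_mean v (\<lambda>x. f x - g x) = word_mean v f - word_mean v g"
  using word_mean_add[OF assms(1), of "\<lambda>x. (-1) * g x" v] assms(2)
  unfolding word_mean_cmult by (simp add: continuous_intros)

lemma word_mean_sum:
  assumes "finite I" "\<And>i. i \<in> I \<Longrightarrow> continuous_on {0..1} (f i)"
  shows "word_mean v (\<lambda>x. \<Sum>i\<in>I. f i x) = (\<Sum>i\<in>I. word_mean v (f i))"
  using assms
proof (induction I rule: finite_induct)
  case (insert i I)
  then show ?case
    by (simp add: word_mean_add continuous_on_sum)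
qed simp

section \<open>Order, norm and Lipschitz estimates for averages\<close>

lemma Re_seg_mean:
  assumes "continuous_on {0..1} f" "x \<in> {0..1}"
  shows "Re (seg_mean b f x) = integral {0..1} (\<lambda>t. Re (f ((1 - t) * x + t * of_bool b)))"
  unfolding seg_mean_def
  using integral_linear[OF integrable_seg[OF assms] bounded_linear_Re] by (simp add: o_def)

lemma Re_seg_mean_mono:
  assumes "continuous_on {0..1} f" "continuous_on {0..1} g"
    and "\<And>x. x \<in> {0..1} \<Longrightarrow> Re (f x) \<le> Re (g x)" "x \<in> {0..1}"
  shows "Re (seg_mean b f x) \<le> Re (seg_mean b g x)"
proof -
  have c: "continuous_on {0..1} (\<lambda>x. Re (f x))" "continuous_on {0..1} (\<lambda>x. Re (g x))"
    using assms by (auto intro: continuous_intros)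
  show ?thesis
    unfolding Re_seg_mean[OF assms(1,4)] Re_seg_mean[OF assms(2,4)]
    by (intro integral_le integrable_seg[where f = "\<lambda>x. Re (f x)"]
        integrable_seg[where f = "\<lambda>x. Re (g x)"] c assms seg_in_unit)
qed

lemma Re_word_mean_mono:
  assumes "continuous_on {0..1} f" "continuous_on {0..1} g"
    and "\<And>x. x \<in> {0..1} \<Longrightarrow> Re (f x) \<le> Re (g x)"
  shows "Re (word_mean v f) \<le> Re (word_mean v g)"
  using assms
proof (induction v arbitrary: f g)
  case (Cons b v)
  have "Re (word_mean v (seg_mean b f)) \<le> Re (word_mean v (seg_mean b g))"
    by (intro Cons.IH continuous_on_seg_mean Re_seg_mean_mono Cons.prems)
  then show ?case by simp
qed simp

lemma norm_seg_mean_le: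
  assumes "continuous_on {0..1} f" "continuous_on {0..1} g"
    and "\<And>x. x \<in> {0..1} \<Longrightarrow> norm (f x) \<le> Re (g x)" "x \<in> {0..1}"
  shows "norm (seg_mean b f x) \<le> Re (seg_mean b g x)"
proof -
  have c: "continuous_on {0..1} (\<lambda>x. Re (g x))"
    using assms by (auto intro: continuous_intros)
  show ?thesis
    unfolding Re_seg_mean[OF assms(2,4)] unfolding seg_mean_def
    by (intro integral_norm_bound_integral integrable_seg c assms seg_in_unit)
qed

text \<open>The majorant is the real part of a complex function because averages are defined on
  complex test functions. The estimate later controls the remainder of a geometric series.\<close>

lemma norm_word_mean_le:
  assumes "continuous_on {0..1} f" "continuous_on {0..1} g"
    and "\<And>x. x \<in> {0..1} \<Longrightarrow> norm (f x) \<le> Re (g x)"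
  shows "norm (word_mean v f) \<le> Re (word_mean v g)"
  using assms
proof (induction v arbitrary: f g)
  case (Cons b v)
  have "norm (word_mean v (seg_mean b f)) \<le> Re (word_mean v (seg_mean b g))"
    by (intro Cons.IH continuous_on_seg_mean norm_seg_mean_le Cons.prems)
  then show ?case by simp
qed simp

lemma integral_one_minus: "integral {0..1::real} (\<lambda>t. 1 - t) = 1 / 2"
proof -
  have "((\<lambda>t::real. 1 - t) has_integral ((1 - 1^2/2) - (0 - 0^2/2))) {0..1}"
    by (rule fundamental_theorem_of_calculus)
      (auto intro!: derivative_eq_intros simp flip: has_real_derivative_iff_has_vector_derivative)
  then show ?thesis by (simp add: integral_unique)
qed

text \<open>For the same \<open>t\<close>, the images of \<open>x\<close> and \<open>y\<close> are
  at distance \<open>(1 - t) * \<bar>x - y\<bar>\<close>, and \<open>1 - t\<close> has mean 1/2;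
  hence every letter halves the Lipschitz constant.\<close>

lemma seg_mean_lipschitz:
  assumes "continuous_on {0..1} f"
    and "\<And>x y. x \<in> {0..1} \<Longrightarrow> y \<in> {0..1} \<Longrightarrow> norm (f x - f y) \<le> L * \<bar>x - y\<bar>"
    and "x \<in> {0..1}" "y \<in> {0..1}"
  shows "norm (seg_mean b f x - seg_mean b f y) \<le> L / 2 * \<bar>x - y\<bar>"
proof -
  let ?p = "\<lambda>x t. (1 - t) * x + t * of_bool b"
  have "seg_mean b f x - seg_mean b f y = integral {0..1} (\<lambda>t. f (?p x t) - f (?p y t))"
    unfolding seg_mean_def by (intro integral_diff[symmetric] integrable_seg assms)
  also have "norm \<dots> \<le> integral {0..1} (\<lambda>t. L * \<bar>x - y\<bar> * (1 - t))"
  proof (rule integral_norm_bound_integral)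
    show "(\<lambda>t. f (?p x t) - f (?p y t)) integrable_on {0..1}"
      by (intro integrable_diff integrable_seg assms)
    show "(\<lambda>t. L * \<bar>x - y\<bar> * (1 - t)) integrable_on {0..1}"
      by (intro integrable_continuous_real continuous_intros)
    fix t :: real assume t: "t \<in> {0..1}"
    have "norm (f (?p x t) - f (?p y t)) \<le> L * \<bar>?p x t - ?p y t\<bar>"
      by (intro assms(2) seg_in_unit assms t)
    also have "?p x t - ?p y t = (1 - t) * (x - y)" by (simp add: algebra_simps)
    finally show "norm (f (?p x t) - f (?p y t)) \<le> L * \<bar>x - y\<bar> * (1 - t)"
      using t by (simp add: abs_mult mult_ac)
  qed
  also have "\<dots> = L / 2 * \<bar>x - y\<bar>"
    by (simp add: integral_one_minus)
  finally show ?thesis .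
qed

lemma seg_mean_False_0: "seg_mean False f 0 = f 0"
  and seg_mean_True_1: "seg_mean True f 1 = f 1"
  unfolding seg_mean_def by simp_all

text \<open>Both are the mean of \<open>f\<close> over all of \<open>{0..1}\<close>, traversed in
  opposite directions. This common value is where the chains of words starting with
  \<open>False\<close> and with \<open>True\<close> are joined.\<close>

lemma seg_mean_False_1: "seg_mean False f 1 = seg_mean True f 0"
proof -
  have "integral {0..1} (\<lambda>t. f (1 - t)) = integral {0..1} f"
    using Henstock_Kurzweil_Integration.integral_reflect_real[of 1 0 "\<lambda>x. f (1 - x)"] 
      integral_shift_Icc_real[of "-1" 0 f 1]
    by (simp add: o_def)
  then show ?thesis unfolding seg_mean_def by simp
qed

section \<open>Continuous logarithms along words\<close>

text \<open>The quotient \<open>g z / f z\<close> stays in the right half plane, where the principal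
  logarithm is continuous, so its logarithm can be added to \<open>h\<close>.\<close>

lemma continuous_log_perturb:
  fixes f g :: "'z::topological_space \<Rightarrow> complex"
  assumes "continuous_on S f" "continuous_on S g" "continuous_on S h"
    and "\<And>z. z \<in> S \<Longrightarrow> f z = exp (h z)"
    and "\<And>z. z \<in> S \<Longrightarrow> norm (f z - g z) < norm (f z)"
  shows "\<exists>h. continuous_on S h \<and> (\<forall>z\<in>S. g z = exp (h z))"
proof -
  have nz: "f z \<noteq> 0" if "z \<in> S" for z using assms(5)[OF that] by auto
  have *: "Re (g z / f z) > 0" if "z \<in> S" for z
  proof -
    have "norm (1 - g z / f z) < 1"
      using assms(5)[OF that] nz[OF that]
      by (simp add: diff_divide_eq_iff norm_divide)
    then show ?thesis using complex_Re_le_cmod[of "1 - g z / f z"] by simp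
  qed
  have "continuous_on S (\<lambda>z. h z + Ln (g z / f z))"
    using assms nz * by (intro continuous_intros) (force simp: complex_nonpos_Reals_iff)+
  moreover have "g z = exp (h z + Ln (g z / f z))" if "z \<in> S" for z
  proof -
    have "g z / f z \<noteq> 0" using *[OF that] by force
    then show ?thesis using assms(4)[OF that] nz[OF that] by (simp add: exp_add)
  qed
  ultimately show ?thesis by blast
qed

text \<open>Induction on \<open>n\<close>: the letter \<open>False\<close> carries the logarithm
  from \<open>f z 0\<close> to the mean of \<open>f z\<close> over \<open>{0..1}\<close>, and
  \<open>True\<close> carries it on to \<open>f z 1\<close>. Fixing a letter halves the Lipschitz
  constant and shortens the remaining words by one, so the threshold \<open>L / 2 ^ n\<close> is
  preserved. For \<open>n = 0\<close> the two endpoints are close enough for a single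
  perturbation.\<close>

lemma continuous_log_transfer:
  fixes f :: "'z::topological_space \<Rightarrow> real \<Rightarrow> complex"
  assumes "continuous_on (S \<times> {0..1}) (\<lambda>(z, x). f z x)"
    and "\<And>z x y. z \<in> S \<Longrightarrow> x \<in> {0..1} \<Longrightarrow> y \<in> {0..1} \<Longrightarrow> norm (f z x - f z y) \<le> L * \<bar>x - y\<bar>"
    and "\<And>z v. z \<in> S \<Longrightarrow> length v = n \<Longrightarrow> L / 2 ^ n < norm (word_mean v (f z))"
    and "\<exists>h. continuous_on S h \<and> (\<forall>z\<in>S. f z 0 = exp (h z))"
  shows "\<exists>h. continuous_on S h \<and> (\<forall>z\<in>S. f z 1 = exp (h z))"
  using assms
proof (induction n arbitrary: f L)
  case 0
  have c: "continuous_on S (\<lambda>z. f z x)" if "x \<in> {0..1}" for x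
  proof -
    have "continuous_on S ((\<lambda>(z, x). f z x) \<circ> (\<lambda>z. (z, x)))"
      by (intro continuous_on_compose continuous_intros) 
        (use that in \<open>auto intro: continuous_on_subset[OF 0(1)]\<close>)
    then show ?thesis by (simp add: o_def)
  qed
  from 0(4) obtain h where "continuous_on S h" "\<forall>z\<in>S. f z 0 = exp (h z)" by blast
  moreover have "norm (f z 0 - f z 1) < norm (f z 0)" if "z \<in> S" for z
    using 0(2)[OF that, of 0 1] 0(3)[OF that, of "[]"] by simp
  ultimately show ?case
    by (intro continuous_log_perturb[of S "\<lambda>z. f z 0" "\<lambda>z. f z 1" h] c) auto
next
  case (Suc n)
  have cz: "continuous_on {0..1} (f z)" if "z \<in> S" for z
  proof -
    have "continuous_on {0..1} ((\<lambda>(z, x). f z x) \<circ> (\<lambda>x. (z, x)))"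
      by (intro continuous_on_compose continuous_intros) 
        (use that in \<open>auto intro: continuous_on_subset[OF Suc.prems(1)]\<close>)
    then show ?thesis by (simp add: o_def)
  qed
  have step: "\<exists>h. continuous_on S h \<and> (\<forall>z\<in>S. seg_mean b (f z) 1 = exp (h z))"
    if h0: "\<exists>h. continuous_on S h \<and> (\<forall>z\<in>S. seg_mean b (f z) 0 = exp (h z))" for b
  proof (rule Suc.IH[where f = "\<lambda>z. seg_mean b (f z)" and L = "L / 2"])
    show "continuous_on (S \<times> {0..1}) (\<lambda>(z, x). seg_mean b (f z) x)"
      by (rule continuous_on_seg_mean_param) (rule Suc.prems)
    show "norm (seg_mean b (f z) x - seg_mean b (f z) y) \<le> (L / 2) * \<bar>x - y\<bar>"
      if "z \<in> S" "x \<in> {0..1}" "y \<in> {0..1}" for z x y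
      by (rule seg_mean_lipschitz) (use that Suc.prems cz in auto)
    show "L / 2 / 2 ^ n < norm (word_mean v (seg_mean b (f z)))" if "z \<in> S" "length v = n" for z v
      using Suc.prems(3)[OF that(1), of "b # v"] that by simp
    show "\<exists>h. continuous_on S h \<and> (\<forall>z\<in>S. seg_mean b (f z) 0 = exp (h z))" by (fact h0)
  qed
  show ?case
    using step[of False] step[of True] Suc.prems(4)
    by (simp add: seg_mean_False_0 seg_mean_False_1 seg_mean_True_1)
qed


section \<open>The Cauchy kernel\<close>

definition cauchy_kernel :: "complex \<Rightarrow> real \<Rightarrow> complex" where
  "cauchy_kernel z x = 1 / (1 - z * of_real x)"

text \<open>With the upper bound that follows, the denominator of the kernel is comparable to
  \<open>norm (1 - z) + (1 - x)\<close>. It is at least \<open>1 - x\<close>, and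
  \<open>norm (1 - z)\<close> exceeds it by at most another \<open>1 - x\<close>; this gives the
  factor 3.\<close>

lemma norm_one_minus_mult_ge:
  fixes z :: complex
  assumes "norm z \<le> 1" "x \<in> {0..1}"
  shows "norm (1 - z) + (1 - x) \<le> 3 * norm (1 - z * of_real x)"
proof -
  have "norm (z * of_real x) \<le> x"
    using assms by (simp add: norm_mult mult_left_le_one_le)
  then have 1: "1 - x \<le> norm (1 - z * of_real x)"
    using norm_triangle_ineq2[of 1 "z * of_real x"] by simp
  have "norm (z * of_real (1 - x)) \<le> 1 - x"
    using assms by (simp add: norm_mult mult_left_le_one_le del: of_real_diff)
  moreover have eq: "(1 - z * of_real x) - z * of_real (1 - x) = 1 - z"
    by (simp add: algebra_simps)
  ultimately have "norm (1 - z) \<le> norm (1 - z * of_real x) + (1 - x)"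
    using norm_triangle_ineq4[of "1 - z * of_real x" "z * of_real (1 - x)"]
    unfolding eq by linarith
  with 1 show ?thesis by simp
qed

lemma norm_one_minus_mult_le:
  fixes z :: complex
  assumes "norm z \<le> 1" "x \<in> {0..1}"
  shows "norm (1 - z * of_real x) \<le> norm (1 - z) + (1 - x)"
proof -
  have "norm (z * of_real (1 - x)) \<le> 1 - x"
    using assms by (simp add: norm_mult mult_left_le_one_le del: of_real_diff)
  moreover have eq: "(1 - z) + z * of_real (1 - x) = 1 - z * of_real x"
    by (simp add: algebra_simps)
  ultimately show ?thesis
    using norm_triangle_ineq[of "1 - z" "z * of_real (1 - x)"]
    unfolding eq by linarith
qed

lemma one_minus_mult_nonzero:
  fixes z :: complex
  assumes "norm z \<le> 1" "z \<noteq> 1" "x \<in> {0..1}"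
  shows "1 - z * of_real x \<noteq> 0"
proof -
  have "norm (1 - z) > 0" "x \<le> 1" using assms by simp_all
  then have "norm (1 - z * of_real x) > 0"
    using norm_one_minus_mult_ge[OF assms(1,3)] by linarith
  then show ?thesis by simp
qed

lemma norm_cauchy_kernel_le:
  assumes "norm z \<le> 1" "z \<noteq> 1" "x \<in> {0..1}"
  shows "norm (cauchy_kernel z x) \<le> 3 / (norm (1 - z) + (1 - x))"
proof -
  have "0 < norm (1 - z) + (1 - x)" "0 < norm (1 - z * of_real x)"
    using assms one_minus_mult_nonzero[OF assms] by (auto simp: add_pos_nonneg)
  then show ?thesis
    using norm_one_minus_mult_ge[OF assms(1,3)]
    by (simp add: cauchy_kernel_def norm_divide field_simps)
qed

lemma continuous_on_cauchy_kernel_param: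
  assumes "\<And>z. z \<in> S \<Longrightarrow> norm z \<le> 1 \<and> z \<noteq> 1"
  shows "continuous_on (S \<times> {0..1}) (\<lambda>(z, x). cauchy_kernel z x)"
  unfolding cauchy_kernel_def case_prod_unfold
  by (intro continuous_intros) (use assms one_minus_mult_nonzero in auto)

lemma continuous_on_cauchy_kernel:
  assumes "norm z \<le> 1" "z \<noteq> 1"
  shows "continuous_on {0..1} (cauchy_kernel z)"
  unfolding cauchy_kernel_def
  by (intro continuous_intros) (use assms one_minus_mult_nonzero in auto)

text \<open>The difference of two kernel values is \<open>z * (x - y)\<close> times their product,
  and each value is at most \<open>3 / norm (1 - z)\<close>. The bound is uniform as long as
  \<open>z\<close> keeps away from 1.\<close>

lemma cauchy_kernel_lipschitz:
  assumes "norm z \<le> 1" "z \<noteq> 1" "x \<in> {0..1}" "y \<in> {0..1}"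
  shows "norm (cauchy_kernel z x - cauchy_kernel z y) \<le> 9 / (norm (1 - z))\<^sup>2 * \<bar>x - y\<bar>"
proof -
  have d: "norm (1 - z) > 0" using assms by simp
  have b: "norm (cauchy_kernel z u) \<le> 3 / norm (1 - z)" if "u \<in> {0..1}" for u
  proof -
    have "3 / (norm (1 - z) + (1 - u)) \<le> 3 / norm (1 - z)"
      using d that by (intro divide_left_mono mult_pos_pos add_pos_nonneg) auto
    then show ?thesis using norm_cauchy_kernel_le[OF assms(1,2) that] by linarith
  qed
  have "cauchy_kernel z x - cauchy_kernel z y
      = z * of_real (x - y) * (cauchy_kernel z x * cauchy_kernel z y)"
    using one_minus_mult_nonzero[OF assms(1,2)] assms(3,4)
    by (simp add: cauchy_kernel_def field_simps)
  also have "norm \<dots> \<le> (1 * \<bar>x - y\<bar>) * ((3 / norm (1 - z)) * (3 / norm (1 - z)))"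
    unfolding norm_mult using assms(1) b[OF assms(3)] b[OF assms(4)]
    by (intro mult_mono) (simp_all add: mult_nonneg_nonneg)
  finally show ?thesis by (simp add: power2_eq_square mult.commute)
qed

text \<open>Inversion maps the disc of radius 1 about 1 to the half plane
  \<open>Re w \<ge> 1/2\<close>. The margin comes from
  \<open>2 * Re u \<ge> (norm u)^2 + (1 - x)\<close> with \<open>u = 1 - z * x\<close>, divided by
  \<open>2 * (norm u)^2\<close>, where \<open>(norm u)^2 \<le> 4\<close>.\<close>

lemma Re_cauchy_kernel_ge:
  assumes "norm z \<le> 1" "z \<noteq> 1" "x \<in> {0..1}"
  shows "Re (cauchy_kernel z x) \<ge> 1/2 + 1/8 * (1 - x)"
proof -
  define u where "u = 1 - z * of_real x"
  have u: "norm u > 0" using one_minus_mult_nonzero[OF assms] by (simp add: u_def)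
  have zx: "norm (z * of_real x) \<le> x"
    using assms by (simp add: norm_mult mult_left_le_one_le)
  then have "norm u \<le> 2"
    using norm_triangle_ineq4[of 1 "z * of_real x"] assms by (simp add: u_def)
  then have u4: "(norm u)\<^sup>2 \<le> 4" using power_mono[of "norm u" 2 2] by simp
  have "(norm (z * of_real x))\<^sup>2 \<le> x\<^sup>2" by (rule power_mono[OF zx]) simp
  also have "\<dots> \<le> x" using assms by (simp add: power2_eq_square mult_left_le)
  finally have zx2: "(norm (z * of_real x))\<^sup>2 \<le> x" .
  have "2 * Re u = (norm u)\<^sup>2 + 1 - (norm (z * of_real x))\<^sup>2"
    unfolding u_def cmod_power2 by (simp add: power2_eq_square algebra_simps)
  then have "2 * Re u \<ge> (norm u)\<^sup>2 + (1 - x)" using zx2 by simp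
  moreover have "(1 - x) * (norm u)\<^sup>2 \<le> (1 - x) * 4"
    using u4 assms by (intro mult_left_mono) auto
  ultimately have "(1/2 + 1/8 * (1 - x)) * (norm u)\<^sup>2 \<le> Re u"
    by (simp add: distrib_right)
  then have "1/2 + 1/8 * (1 - x) \<le> Re u / (norm u)\<^sup>2"
    using u by (simp add: pos_le_divide_eq)
  also have "\<dots> = Re (cauchy_kernel z x)"
    by (simp add: cauchy_kernel_def u_def[symmetric] Re_divide cmod_power2)
  finally show ?thesis .
qed

text \<open>A letter multiplies the distance to 1 by at least \<open>1 - t\<close>, whose mean is
  1/2, so the margin is at worst halved by each letter. The empty word evaluates at 0, where the
  remaining margin is positive; thus the inequality is strict.\<close>

lemma Re_word_mean_gt:
  assumes "continuous_on {0..1} f" "m > 0"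
    and "\<And>x. x \<in> {0..1} \<Longrightarrow> Re (f x) \<ge> c + m * (1 - x)"
  shows "Re (word_mean v f) > c"
  using assms
proof (induction v arbitrary: f m)
  case Nil
  then show ?case using Nil(3)[of 0] by simp
next
  case (Cons b v)
  have "Re (seg_mean b f x) \<ge> c + m / 2 * (1 - x)" if x: "x \<in> {0..1}" for x
  proof -
    have "c + m / 2 * (1 - x) = integral {0..1} (\<lambda>t. c + m * (1 - x) * (1 - t))"
      by (subst integral_add)
        (auto simp: integral_one_minus intro!: integrable_continuous_real continuous_intros)
    also have "\<dots> \<le> integral {0..1} (\<lambda>t. Re (f ((1 - t) * x + t * of_bool b)))"
    proof (rule integral_le)
      have "continuous_on {0..1} (\<lambda>x. Re (f x))"
        using Cons.prems by (intro continuous_intros)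
      then show "(\<lambda>t. Re (f ((1 - t) * x + t * of_bool b))) integrable_on {0..1}"
        by (rule integrable_seg[where f = "\<lambda>x. Re (f x)", OF _ x])
      show "(\<lambda>t. c + m * (1 - x) * (1 - t)) integrable_on {0..1}"
        by (intro integrable_continuous_real continuous_intros)
      fix t :: real assume t: "t \<in> {0..1}"
      have "(1 - x) * (1 - t) \<le> 1 - ((1 - t) * x + t * of_bool b)"
        using t by (cases b) (auto simp: algebra_simps)
      then have "m * ((1 - x) * (1 - t)) \<le> m * (1 - ((1 - t) * x + t * of_bool b))"
        using Cons.prems(2) by (intro mult_left_mono) auto
      then show "c + m * (1 - x) * (1 - t) \<le> Re (f ((1 - t) * x + t * of_bool b))"
        using Cons.prems(3)[OF seg_in_unit[OF x t, of b]] by (simp add: mult.assoc)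
    qed
    finally show ?thesis by (simp add: Re_seg_mean[OF Cons.prems(1) x])
  qed
  then have "c < Re (word_mean v (seg_mean b f))"
    using Cons.prems by (intro Cons.IH[where m = "m / 2"] continuous_on_seg_mean) auto
  then show ?case by simp
qed

section \<open>Moments\<close>

text \<open>The moments of the random point of the word, given by the action of the two letters on
  monomials (see \<open>word_mean_power\<close>). The empty word is the point mass at 0, with
  \<open>0 ^ 0 = 1\<close>.\<close>

primrec moment :: "bool list \<Rightarrow> nat \<Rightarrow> real" where
  "moment [] n = 0 ^ n"
| "moment (b # v) n = (if b then \<Sum>m\<le>n. moment v m else moment v n) / Suc n"

lemma seg_mean_of_real:
  assumes "((\<lambda>t. g ((1 - t) * x + t * of_bool b)) has_integral I) {0..1}"
  shows "seg_mean b (\<lambda>x. of_real (g x)) x = of_real I"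
  using has_integral_linear[OF assms bounded_linear_of_real]
  unfolding seg_mean_def o_def by (rule integral_unique)

lemma seg_mean_False_power:
  "seg_mean False (\<lambda>x. of_real x ^ n) x = of_real x ^ n / of_nat (Suc n)"
proof -
  have "((\<lambda>t. - (x ^ n / Suc n) * (1 - t) ^ Suc n) has_real_derivative
      ((1 - t) * x + t * of_bool False) ^ n) (at t within {0..1})" for t
  proof -
    have "((\<lambda>t. (1 - t) ^ Suc n) has_real_derivative
        real (Suc n) * (1 - t) ^ n * (- 1)) (at t within {0..1})"
      by (rule derivative_eq_intros refl | simp)+
    from DERIV_cmult[OF this, of "- (x ^ n / Suc n)"] show ?thesis
      by (simp add: power_mult_distrib mult.commute del: of_nat_Suc power_Suc)
  qed
  then have "((\<lambda>t. ((1 - t) * x + t * of_bool False) ^ n) has_integral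
      (- (x ^ n / Suc n) * (1 - 1) ^ Suc n - (- (x ^ n / Suc n) * (1 - 0) ^ Suc n))) {0..1}"
    by (intro fundamental_theorem_of_calculus)
      (simp_all flip: has_real_derivative_iff_has_vector_derivative)
  from seg_mean_of_real[OF this] show ?thesis by simp
qed

lemma seg_mean_True_power:
  "seg_mean True (\<lambda>x. of_real x ^ n) x = (\<Sum>m\<le>n. of_real x ^ m) / of_nat (Suc n)"
\<comment> \<open>The antiderivative used for the other case has \<open>1 - x\<close> in its
  denominator.\<close>
proof (cases "x = 1")
  case True
  then show ?thesis by (simp add: seg_mean_True_1 del: of_nat_Suc)
next
  case False
  define c where "c = real (Suc n) * (1 - x)"
  have c: "c \<noteq> 0" using False by (simp add: c_def)
  have "((\<lambda>t. ((1 - t) * x + t * of_bool True) ^ Suc n / c) has_real_derivative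
      ((1 - t) * x + t * of_bool True) ^ n) (at t within {0..1})" for t
  proof -
    have "((\<lambda>t. ((1 - t) * x + t * of_bool True) ^ Suc n) has_real_derivative
        real (Suc n) * ((1 - t) * x + t * of_bool True) ^ n * (1 - x)) (at t within {0..1})"
      by (rule derivative_eq_intros refl | simp)+
    from DERIV_cdivide[OF this, of c] show ?thesis using c by (simp add: c_def)
  qed
  then have "((\<lambda>t. ((1 - t) * x + t * of_bool True) ^ n) has_integral
      ((1 - 1) * x + 1 * of_bool True) ^ Suc n / c - ((1 - 0) * x + 0 * of_bool True) ^ Suc n / c) {0..1}"
    by (intro fundamental_theorem_of_calculus)
      (simp_all flip: has_real_derivative_iff_has_vector_derivative)
  also have "((1 - 1) * x + 1 * of_bool True) ^ Suc n / c - ((1 - 0) * x + 0 * of_bool True) ^ Suc n / c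
      = (1 - x ^ Suc n) / (1 - x) / Suc n"
    by (simp add: c_def diff_divide_distrib mult.commute del: of_nat_Suc power_Suc)
  also have "(1 - x ^ Suc n) / (1 - x) = (\<Sum>m\<le>n. x ^ m)"
    using False by (simp add: sum_gp0)
  finally show ?thesis using seg_mean_of_real[of "\<lambda>x. x ^ n"] by simp
qed

lemma word_mean_power: "word_mean v (\<lambda>x. of_real x ^ n) = of_real (moment v n)"
proof (induction v arbitrary: n)
  case (Cons b v)
  have c: "continuous_on {0..1} (\<lambda>x::real. of_real x ^ m :: complex)" for m
    by (intro continuous_intros)
  show ?case
  proof (cases b)
    case True
    have "seg_mean b (\<lambda>x. of_real x ^ n) = (\<lambda>x. (1 / of_nat (Suc n)) * (\<Sum>m\<le>n. of_real x ^ m))"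
      using True seg_mean_True_power by (simp add: fun_eq_iff)
    then show ?thesis
      using True Cons by (simp only: word_mean.simps word_mean_cmult) (simp add: word_mean_sum c)
  next
    case False
    have "seg_mean b (\<lambda>x. of_real x ^ n) = (\<lambda>x. (1 / of_nat (Suc n)) * of_real x ^ n)"
      using False seg_mean_False_power by (simp add: fun_eq_iff)
    then show ?thesis
      using False Cons by (simp only: word_mean.simps word_mean_cmult) simp
  qed
qed simp

lemma moment_nonneg: "0 \<le> moment v n"
proof (induction v arbitrary: n)
  case (Cons b v)
  then show ?case by (auto intro!: divide_nonneg_nonneg sum_nonneg simp del: of_nat_Suc)
qed simp

lemma sum_inverse_sqrt_le: "(\<Sum>m\<le>n. 1 / sqrt (Suc m)) \<le> 2 * sqrt (Suc n)"
proof (induction n)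
  case (Suc n)
  define a b where "a = sqrt (Suc n)" and "b = sqrt (Suc (Suc n))"
  have ab: "0 < a" "a \<le> b" "b * b = a * a + 1" by (simp_all add: a_def b_def)
  \<comment> \<open>Together with \<open>b * b = a * a + 1\<close> this gives
    \<open>1 / b \<le> 2 * (b - a)\<close>, which telescopes.\<close>
  have "(b - a) * (b - a) \<ge> 0" by simp
  then have "2 * a * b + 1 \<le> 2 * b * b" using ab(3) by (simp add: algebra_simps)
  then have "2 * a + 1 / b \<le> 2 * b" using ab by (simp add: field_simps)
  then show ?case using Suc by (simp add: a_def b_def)
qed simp

text \<open>The rate \<open>1 / sqrt (Suc n)\<close> is stable under both letters up to a constant:
  averaging over \<open>m \<le> n\<close> at most doubles \<open>C\<close>, and dividing by
  \<open>Suc n\<close> only helps. It suffices for the moments to vanish at infinity and for the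
  series at \<open>z = 1\<close> to converge.\<close>

lemma moment_le: "\<exists>C\<ge>0. \<forall>n. moment v n \<le> C / sqrt (Suc n)"
proof (induction v)
  case Nil
  have "(0::real) ^ n \<le> 1 / sqrt (Suc n)" for n by (cases n) auto
  then show ?case by (intro exI[of _ 1]) simp
next
  case (Cons b v)
  then obtain C where C: "C \<ge> 0" "\<And>n. moment v n \<le> C / sqrt (Suc n)" by blast
  have "moment (b # v) n \<le> 2 * C / sqrt (Suc n)" for n
  proof (cases b)
    case True
    have "(\<Sum>m\<le>n. moment v m) \<le> (\<Sum>m\<le>n. C * (1 / sqrt (Suc m)))"
      using C by (intro sum_mono) simp
    also have "\<dots> \<le> C * (2 * sqrt (Suc n))"
      unfolding sum_distrib_left[symmetric] using C(1) by (intro mult_left_mono sum_inverse_sqrt_le)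
    finally have "(\<Sum>m\<le>n. moment v m) / Suc n \<le> C * (2 * sqrt (Suc n)) / Suc n"
      by (intro divide_right_mono) auto
    also have "\<dots> = 2 * C / sqrt (Suc n)"
      by (simp add: field_simps flip: power2_eq_square)
    finally show ?thesis using True by simp
  next
    case False
    have "moment v n / Suc n \<le> moment v n"
      using moment_nonneg[of v n] by (simp add: divide_le_eq mult_left_le algebra_simps)
    also have "\<dots> \<le> 2 * C / sqrt (Suc n)"
      using C(1) by (intro order_trans[OF C(2)] divide_right_mono) auto
    finally show ?thesis using False by simp
  qed
  then show ?case using C(1) by (intro exI[of _ "2 * C"]) auto
qed

lemma moment_tendsto_0: "moment v \<longlonglongrightarrow> 0"
proof -
  obtain C where C: "\<And>n. moment v n \<le> C / sqrt (Suc n)" using moment_le by blast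
  have "(\<lambda>n. C / sqrt (Suc n)) \<longlonglongrightarrow> 0"
    by (intro real_tendsto_divide_at_top[OF tendsto_const] 
       filterlim_compose[OF sqrt_at_top] filterlim_compose[OF filterlim_real_sequentially] filterlim_Suc)
  then show ?thesis
    by (rule Lim_null_comparison[rotated]) (use C moment_nonneg in auto)
qed

lemma summable_moment_div: "summable (\<lambda>n. moment v n / Suc n)"
proof -
  obtain C where C: "\<And>n. moment v n \<le> C / sqrt (Suc n)" using moment_le by blast
  have "summable (\<lambda>n. C * real (Suc n) powr (-3/2))"
  proof (rule summable_mult)
    have "summable (\<lambda>n. real n powr (-3/2))" by (simp add: summable_real_powr_iff)
    then show "summable (\<lambda>n. real (Suc n) powr (-3/2))"
      by (rule summable_Suc_iff[where f = "\<lambda>n. real n powr (-3/2)", THEN iffD2])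
  qed
  moreover have "norm (moment v n / Suc n) \<le> C * real (Suc n) powr (-3/2)" for n
  proof -
    have "moment v n / Suc n \<le> C / sqrt (Suc n) / Suc n"
      by (intro divide_right_mono C) auto
    also have "\<dots> = C * (real (Suc n) powr -(1/2) * real (Suc n) powr -1)"
      by (simp add: powr_minus_divide powr_half_sqrt del: of_nat_Suc)
    also have "real (Suc n) powr -(1/2) * real (Suc n) powr -1 = real (Suc n) powr (-3/2)"
    proof -
      have e: "(-3/2::real) = -(1/2) + -1" by simp
      show ?thesis unfolding e by (rule powr_add[symmetric])
    qed
    finally show ?thesis
      by (simp only: real_norm_def abs_of_nonneg moment_nonneg divide_nonneg_nonneg of_nat_0_le_iff)
  qed
  ultimately show ?thesis by (rule summable_comparison_test'[where N = 0])
qed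

text \<open>The kernel is expanded as a geometric series in \<open>z * x\<close>. The average of the
  remainder is at most \<open>3 / norm (1 - z)\<close> times the moment of order \<open>N\<close>,
  which tends to 0; this yields convergence on the boundary circle away from 1, where the series may
  fail to converge absolutely.\<close>

lemma moment_sums_word_mean:
  assumes "norm z \<le> 1" "z \<noteq> 1"
  shows "(\<lambda>n. z ^ n * of_real (moment v n)) sums word_mean v (cauchy_kernel z)"
proof -
  note ck = continuous_on_cauchy_kernel[OF assms]
  define r where "r N = (\<lambda>x. (z * of_real x) ^ N * cauchy_kernel z x)" for N
  have cr: "continuous_on {0..1} (r N)" for N
    unfolding r_def by (intro continuous_intros ck)
  have c: "continuous_on {0..1} (\<lambda>x::real. of_real x ^ m :: complex)" for m
    by (intro continuous_intros)
  have partial: "(\<Sum>n<N. z ^ n * of_real (moment v n)) = word_mean v (cauchy_kernel z) - word_mean v (r N)" for N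
  proof -
    have "(\<Sum>n<N. z ^ n * of_real (moment v n)) = word_mean v (\<lambda>x. \<Sum>n<N. z ^ n * of_real x ^ n)"
    proof -
      have "word_mean v (\<lambda>x. \<Sum>n<N. z ^ n * of_real x ^ n)
          = (\<Sum>n<N. word_mean v (\<lambda>x. z ^ n * of_real x ^ n))"
        by (intro word_mean_sum continuous_intros) simp
      then show ?thesis by (simp only: word_mean_cmult word_mean_power)
    qed
    also have "\<dots> = word_mean v (\<lambda>x. cauchy_kernel z x - r N x)"
    proof (rule word_mean_cong)
      fix x :: real assume "x \<in> {0..1}"
      then have "1 - z * of_real x \<noteq> 0" by (rule one_minus_mult_nonzero[OF assms])
      then show "(\<Sum>n<N. z ^ n * of_real x ^ n) = cauchy_kernel z x - r N x"
        by (simp add: r_def cauchy_kernel_def sum_gp_strict diff_divide_distrib flip: power_mult_distrib)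
    qed
    also have "\<dots> = word_mean v (cauchy_kernel z) - word_mean v (r N)"
      by (rule word_mean_diff[OF ck cr])
    finally show ?thesis .
  qed
  have bound: "norm (word_mean v (r N)) \<le> 3 / norm (1 - z) * moment v N" for N
  proof -
    have "norm (word_mean v (r N)) \<le> Re (word_mean v (\<lambda>x. of_real (3 / norm (1 - z)) * of_real x ^ N))"
    proof (rule norm_word_mean_le[OF cr])
      show "continuous_on {0..1} (\<lambda>x::real. of_real (3 / norm (1 - z)) * of_real x ^ N :: complex)"
        by (intro continuous_intros)
      fix x :: real assume x: "x \<in> {0..1}"
      have "norm (z * of_real x) ^ N \<le> x ^ N"
        using assms(1) x by (intro power_mono) (auto simp: norm_mult mult_left_le_one_le)
      moreover have "norm (cauchy_kernel z x) \<le> 3 / norm (1 - z)"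
      proof -
        have "3 / (norm (1 - z) + (1 - x)) \<le> 3 / norm (1 - z)"
          using assms x by (intro divide_left_mono mult_pos_pos add_pos_nonneg) auto
        then show ?thesis using norm_cauchy_kernel_le[OF assms x] by linarith
      qed
      ultimately have "norm (r N x) \<le> x ^ N * (3 / norm (1 - z))"
        unfolding r_def norm_mult norm_power using x by (intro mult_mono) auto
      also have "\<dots> = Re (of_real (3 / norm (1 - z) * x ^ N))" by simp
      finally show "norm (r N x) \<le> Re (of_real (3 / norm (1 - z)) * of_real x ^ N)"
        by (simp only: of_real_mult of_real_power)
    qed
    also have "\<dots> = Re (of_real (3 / norm (1 - z) * moment v N))"
      by (simp only: word_mean_cmult word_mean_power of_real_mult)
    finally show ?thesis by simp
  qed
  have "(\<lambda>N. 3 / norm (1 - z) * moment v N) \<longlonglongrightarrow> 3 / norm (1 - z) * 0"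
    by (intro tendsto_intros moment_tendsto_0)
  then have "(\<lambda>N. word_mean v (r N)) \<longlonglongrightarrow> 0"
    by (intro Lim_null_comparison[OF always_eventually, OF allI, OF bound]) simp
  then have "(\<lambda>N. word_mean v (cauchy_kernel z) - word_mean v (r N)) \<longlonglongrightarrow> word_mean v (cauchy_kernel z) - 0"
    by (intro tendsto_intros)
  then show ?thesis unfolding sums_def partial by simp
qed


section \<open>Star sums\<close>

lemma star_tuples_Suc_0: "star_tuples (Suc 0) (Suc n) = {[Suc n]}"
  unfolding star_tuples_def by (auto simp: length_Suc_conv)

lemma star_tuples_Suc_Suc:
  "star_tuples (Suc (Suc r)) (Suc n) = (#) (Suc n) ` (\<Union>m\<le>n. star_tuples (Suc r) (Suc m))"
proof (intro set_eqI iffI)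
  fix ns assume "ns \<in> star_tuples (Suc (Suc r)) (Suc n)"
  then obtain a ms where ns: "ns = Suc n # a # ms" "length ms = r" "sorted_wrt (\<ge>) (a # ms)"
      "a \<le> Suc n" "\<forall>m\<in>set (a # ms). 1 \<le> m"
    by (auto simp: star_tuples_def length_Suc_conv)
  \<comment> \<open>The outer variable is indexed by its predecessor; \<open>a \<ge> 1\<close> makes
    \<open>Suc (a - 1)\<close> equal to \<open>a\<close>.\<close>
  then have "a # ms \<in> star_tuples (Suc r) (Suc (a - 1))" "a - 1 \<le> n"
    by (auto simp: star_tuples_def)
  then show "ns \<in> (#) (Suc n) ` (\<Union>m\<le>n. star_tuples (Suc r) (Suc m))"
    using ns(1) by blast
next
  fix ns assume "ns \<in> (#) (Suc n) ` (\<Union>m\<le>n. star_tuples (Suc r) (Suc m))"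
  then obtain m ms where "ns = Suc n # ms" "m \<le> n" "ms \<in> star_tuples (Suc r) (Suc m)" by blast
  then show "ns \<in> star_tuples (Suc (Suc r)) (Suc n)"
    by (auto simp: star_tuples_def length_Suc_conv) (meson Suc_le_mono le_trans)
qed

lemma finite_star_tuples: "finite (star_tuples (Suc r) (Suc n))"
  by (induction r arbitrary: n) (simp_all add: star_tuples_Suc_0 star_tuples_Suc_Suc)

definition star_coeff :: "nat list \<Rightarrow> nat \<Rightarrow> real" where
  "star_coeff ks n =
     (\<Sum>ns\<in>star_tuples (length ks) (Suc n). \<Prod>i<length ks. 1 / real (ns ! i) ^ (ks ! i))"

lemma star_coeff_single: "star_coeff [k] n = 1 / real (Suc n) ^ k"
  by (simp add: star_coeff_def star_tuples_Suc_0)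

lemma star_coeff_Cons:
  assumes "ks \<noteq> []"
  shows "star_coeff (k # ks) n = (\<Sum>m\<le>n. star_coeff ks m) / real (Suc n) ^ k"
proof -
  obtain r where r: "length ks = Suc r" using assms by (cases ks) auto
  have disj: "star_tuples (Suc r) (Suc m) \<inter> star_tuples (Suc r) (Suc m') = {}" if "m \<noteq> m'" for m m'
    using that by (auto simp: star_tuples_def)
  have "star_coeff (k # ks) n = (\<Sum>ns\<in>(\<Union>m\<le>n. star_tuples (Suc r) (Suc m)).
      \<Prod>i<Suc (Suc r). 1 / real ((Suc n # ns) ! i) ^ ((k # ks) ! i))"
    unfolding star_coeff_def by (simp add: r star_tuples_Suc_Suc sum.reindex del: prod.lessThan_Suc)
  also have "\<dots> = (\<Sum>ns\<in>(\<Union>m\<le>n. star_tuples (Suc r) (Suc m)).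
      (\<Prod>i<Suc r. 1 / real (ns ! i) ^ (ks ! i)) / real (Suc n) ^ k)"
    unfolding prod.lessThan_Suc_shift[of _ "Suc r"] by (simp del: prod.lessThan_Suc of_nat_Suc)
  also have "\<dots> = (\<Sum>m\<le>n. \<Sum>ns\<in>star_tuples (Suc r) (Suc m).
      (\<Prod>i<Suc r. 1 / real (ns ! i) ^ (ks ! i)) / real (Suc n) ^ k)"
    by (rule sum.UNION_disjoint) (use disj finite_star_tuples in auto)
  also have "\<dots> = (\<Sum>m\<le>n. star_coeff ks m) / real (Suc n) ^ k"
    by (simp only: star_coeff_def r sum_divide_distrib)
  finally show ?thesis .
qed

lemma star_value_eq_suminf:
  "star_value z ks = (\<Sum>m. z ^ m * of_real (star_coeff ks m))"
proof -
  have "(\<Sum>ns\<in>star_tuples (length ks) (Suc m).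
        z ^ (hd ns - 1) / (\<Prod>i<length ks. of_nat (ns ! i) ^ (ks ! i)))
      = z ^ m * of_real (star_coeff ks m)" for m
    unfolding star_coeff_def of_real_sum sum_distrib_left
    by (rule sum.cong) (auto simp: star_tuples_def prod_dividef)
  then show ?thesis unfolding star_value_def by simp
qed

primrec index_word :: "nat list \<Rightarrow> bool list" where
  "index_word [] = []"
| "index_word (k # ks) = replicate (k - 1) False @ True # index_word ks"

lemma moment_replicate_False_append:
  "moment (replicate j False @ v) n = moment v n / real (Suc n) ^ j"
  by (induction j) simp_all

lemma moment_0_right [simp]: "moment v 0 = 1"
  by (induction v) simp_all

text \<open>Every letter divides by \<open>Suc n\<close>, the value of the outer variable, so the
  block of \<open>k\<close> letters supplies its power \<open>k\<close>. The \<open>True\<close>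
  closing the block also performs the summation over the next variable.\<close>

lemma star_coeff_eq_moment:
  assumes "ks \<noteq> []" "\<forall>k\<in>set ks. 1 \<le> k"
  shows "star_coeff ks n = moment (index_word ks) n"
  using assms
proof (induction ks arbitrary: n rule: list_nonempty_induct)
  case (single k)
  then obtain j where "k = Suc j" by (cases k) auto
  \<comment> \<open>The innermost block acts on the point mass at 0, whose only nonzero moment is
    the one of order 0.\<close>
  moreover have "(\<Sum>m\<le>n. (0::real) ^ m) = 1"
    by (simp add: sum.atMost_shift)
  ultimately show ?case
    by (simp add: star_coeff_single moment_replicate_False_append del: of_nat_Suc)
next
  case (cons k ks)
  then obtain j where "k = Suc j" by (cases k) auto
  with cons show ?case
    by (simp add: star_coeff_Cons moment_replicate_False_append del: of_nat_Suc)
qed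

text \<open>The letter \<open>False\<close> fixes 0, so the letters behind the last
  \<open>True\<close> of a word have no effect. Prepending \<open>True\<close> opens a new index 1,
  and prepending \<open>False\<close> raises the first index by one.\<close>

lemma moment_cases:
  obtains "\<forall>n. moment v n = 0 ^ n"
  | ks where "ks \<noteq> []" "\<forall>k\<in>set ks. 1 \<le> k" "moment v = moment (index_word ks)"
proof -
  have "(\<forall>n. moment v n = 0 ^ n) \<or>
    (\<exists>ks. ks \<noteq> [] \<and> (\<forall>k\<in>set ks. 1 \<le> k) \<and> moment v = moment (index_word ks))"
  proof (induction v)
    case (Cons b v)
    from Cons.IH consider "\<forall>n. moment v n = 0 ^ n"
      | ks where "ks \<noteq> []" "\<forall>k\<in>set ks. 1 \<le> k" "moment v = moment (index_word ks)" by blast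
    then show ?case
    proof cases
      case 1
      show ?thesis
      proof (cases b)
        case True
        have "moment (b # v) = moment (index_word [1])"
          using True 1 by (simp add: fun_eq_iff)
        then show ?thesis by (intro disjI2 exI[of _ "[1]"]) simp
      next
        case False
        then have "moment (b # v) n = 0 ^ n" for n using 1 by (cases n) auto
        then show ?thesis by blast
      qed
    next
      case (2 ks)
      show ?thesis
      proof (cases b)
        case True
        have "moment (b # v) = moment (index_word (1 # ks))"
          using True 2 by (simp add: fun_eq_iff)
        then show ?thesis using 2 by (intro disjI2 exI[of _ "1 # ks"]) simp
      next
        case False
        obtain k ls where ks: "ks = Suc k # ls"
          using 2(1,2) by (cases ks; cases "hd ks") auto
        have "moment (b # v) = moment (index_word (Suc (Suc k) # ls))"
          using False 2 ks by (simp add: fun_eq_iff)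
        then show ?thesis using 2 ks by (intro disjI2 exI[of _ "Suc (Suc k) # ls"]) simp
      qed
    qed
  qed simp
  then show ?thesis using that by blast
qed

lemma star_value_eq_word_mean:
  assumes "norm z \<le> 1" "z \<noteq> 1" "ks \<noteq> []" "\<forall>k\<in>set ks. 1 \<le> k" "moment v = moment (index_word ks)"
  shows "star_value z ks = word_mean v (cauchy_kernel z)"
  using moment_sums_word_mean[OF assms(1,2), of v] star_coeff_eq_moment[OF assms(3,4)] assms(5)
  by (simp add: star_value_eq_suminf sums_iff)

section \<open>Location, countability and closure of the values\<close>

lemma norm_root_of_unity:
  assumes "z \<in> roots_of_unity N" "N \<ge> 1"
  shows "norm z = 1"
  using assms power_eq_1_iff[of z N] by (auto simp: roots_of_unity_def)

lemma C_star_subset_open_half_plane: "C_star \<subseteq> open_half_plane"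
proof
  fix w assume "w \<in> C_star"
  then obtain N z ks where N: "N \<ge> 1" "z \<in> roots_of_unity N" and w: "w = star_value z ks"
    and ks: "length ks \<ge> 1" "\<forall>k\<in>set ks. 1 \<le> k" and ne: "(hd ks, z) \<noteq> (1, 1)"
    by (auto simp: C_star_def)
  have z: "norm z = 1" using N norm_root_of_unity by blast
  have ks0: "ks \<noteq> []" using ks(1) by auto
  show "w \<in> open_half_plane"
  proof (cases "z = 1")
    case False
    have "w = word_mean (index_word ks) (cauchy_kernel z)"
      unfolding w using z False by (intro star_value_eq_word_mean ks0 ks(2)) auto
    moreover have "Re (word_mean (index_word ks) (cauchy_kernel z)) > 1/2"
      using z False
      by (intro Re_word_mean_gt[where m = "1/8"] continuous_on_cauchy_kernel Re_cauchy_kernel_ge) auto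
    ultimately show ?thesis by (simp add: open_half_plane_def)
  next
    case True
    obtain k ls where k: "ks = Suc (Suc k) # ls"
    proof (cases ks)
      case (Cons k ls)
      with True ne ks(2) have "k \<ge> 2" by auto
      then show ?thesis using Cons that[of "k - 2"] by (auto simp: numeral_2_eq_2)
    qed (use ks0 in simp)
    \<comment> \<open>One of the \<open>k + 1\<close> leading letters \<open>False\<close> is split
      off, which makes a factor \<open>1 / Suc n\<close> explicit and gives convergence at
      1.\<close>
    define v where "v = replicate k False @ True # index_word ls"
    have c: "star_coeff ks n = moment v n / Suc n" for n
      using star_coeff_eq_moment[OF ks0 ks(2), of n] by (simp add: k v_def)
    have sm: "summable (\<lambda>n. moment v n / Suc n)" by (rule summable_moment_div)
    have "w = of_real (\<Sum>n. moment v n / Suc n)"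
      unfolding w star_value_eq_suminf True using suminf_of_real[OF sm, where 'a = complex]
      by (simp add: c)
    \<comment> \<open>The first term is 1 and all terms are nonnegative, so the real number
      \<open>w\<close> is at least 1.\<close>
    moreover have "(\<Sum>n<1. moment v n / Suc n) \<le> (\<Sum>n. moment v n / Suc n)"
      by (intro sum_le_suminf sm) (auto intro: divide_nonneg_nonneg moment_nonneg simp del: of_nat_Suc)
    ultimately show ?thesis by (simp add: open_half_plane_def)
  qed
qed

text \<open>Words without \<open>True\<close> leave the point mass at 0 unchanged and give the value
  1. This exception is harmless later, since density is first proved off the real axis.\<close>

lemma word_mean_kernel_in_C_star:
  assumes "N \<ge> 1" "z \<in> roots_of_unity N" "z \<noteq> 1"
  shows "word_mean v (cauchy_kernel z) = 1 \<or> word_mean v (cauchy_kernel z) \<in> C_star"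
proof (cases rule: moment_cases[of v])
  case 1
  have z: "norm z \<le> 1" using norm_root_of_unity[OF assms(2,1)] by simp
  have "(\<lambda>n. z ^ n * of_real (moment v n)) = (\<lambda>n. if n = 0 then 1 else 0)"
    using 1 by (auto simp: fun_eq_iff)
  then have "word_mean v (cauchy_kernel z) = 1"
    using moment_sums_word_mean[OF z assms(3), of v] sums_single[of 0 "\<lambda>_. 1 :: complex"]
    by (simp add: sums_iff)
  then show ?thesis by blast
next
  case (2 ks)
  have "star_value z ks = word_mean v (cauchy_kernel z)"
    by (intro star_value_eq_word_mean 2 assms) (use norm_root_of_unity[OF assms(2,1)] in simp)
  moreover have "star_value z ks \<in> C_star"
  proof -
    have "star_value z ks = star_value z ks \<and> z \<in> roots_of_unity N \<and> length ks \<ge> 1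
        \<and> (\<forall>k\<in>set ks. 1 \<le> k) \<and> (hd ks, z) \<noteq> (1, 1)"
      using assms 2(1,2) by (cases ks) simp_all
    then show ?thesis using assms(1) unfolding C_star_def by blast
  qed
  ultimately show ?thesis by simp
qed

lemma countable_C_star: "countable C_star"
proof -
  have "finite (roots_of_unity N)" if "N \<ge> 1" for N
    unfolding roots_of_unity_def by (rule finite_roots_unity[OF that])
  then have "countable (\<Union>N\<in>{1..}. roots_of_unity N)"
    by (intro countable_UN[OF countableI_type] countable_finite) simp
  then have "countable ((\<Union>N\<in>{1..}. roots_of_unity N) \<times> (UNIV :: nat list set))"
    by (intro countable_SIGMA countableI_type)
  then have "countable ((\<lambda>(z, ks). star_value z ks) ` ((\<Union>N\<in>{1..}. roots_of_unity N) \<times> UNIV))"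
    by (rule countable_image)
  moreover have "C_star \<subseteq> (\<lambda>(z, ks). star_value z ks) ` ((\<Union>N\<in>{1..}. roots_of_unity N) \<times> UNIV)"
    unfolding C_star_def by blast
  ultimately show ?thesis by (rule countable_subset[rotated])
qed

text \<open>The angle divided by \<open>2 * pi\<close> is approximated by its roundings down to
  multiples of \<open>1 / Suc n\<close>.\<close>

lemma roots_of_unity_dense:
  assumes "norm z = 1" "\<epsilon> > 0"
  obtains N u where "N \<ge> 1" "u \<in> roots_of_unity N" "dist u z < \<epsilon>"
proof -
  have "cis (Arg z) = z" using rcis_cmod_Arg[of z] assms(1) by (simp add: rcis_def)
  then obtain t where t: "z = cis t" by metis
  define s where "s = t / (2 * pi)"
  have s: "2 * pi * s = t" by (simp add: s_def)
  define q where "q n = real_of_int \<lfloor>real (Suc n) * s\<rfloor> / real (Suc n)" for n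
  have "q \<longlonglongrightarrow> s"
  proof (rule real_tendsto_sandwich)
    show "(\<lambda>n. s - inverse (real (Suc n))) \<longlonglongrightarrow> s"
      using tendsto_diff[OF tendsto_const LIMSEQ_inverse_real_of_nat, of s] by simp
    have "(real (Suc n) * s - 1) / real (Suc n) \<le> q n" for n
      unfolding q_def by (intro divide_right_mono real_of_int_floor_ge_diff_one) simp
    then show "\<forall>\<^sub>F n in sequentially. s - inverse (real (Suc n)) \<le> q n"
      by (intro always_eventually allI)
        (simp add: diff_divide_distrib inverse_eq_divide del: of_nat_Suc)
    have "q n \<le> real (Suc n) * s / real (Suc n)" for n
      unfolding q_def by (intro divide_right_mono of_int_floor_le) simp
    then show "\<forall>\<^sub>F n in sequentially. q n \<le> s"
      by (intro always_eventually allI) (simp del: of_nat_Suc)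
  qed simp
  then have "(\<lambda>n. cis (2 * pi * q n)) \<longlonglongrightarrow> cis (2 * pi * s)"
    by (intro tendsto_intros)
  then obtain n where n: "dist (cis (2 * pi * q n)) (cis (2 * pi * s)) < \<epsilon>"
    using assms(2) unfolding lim_sequentially by blast
  have "real (Suc n) * (2 * pi * q n) = 2 * pi * real_of_int \<lfloor>real (Suc n) * s\<rfloor>"
    unfolding q_def by (simp del: of_nat_Suc)
  then have "cis (2 * pi * q n) ^ Suc n = cis (2 * pi * real_of_int \<lfloor>real (Suc n) * s\<rfloor>)"
    unfolding Complex.DeMoivre by (rule arg_cong)
  also have "\<dots> = 1" by (rule cis_multiple_2pi) auto
  finally show ?thesis
    using n by (intro that[of "Suc n" "cis (2 * pi * q n)"]) (simp_all add: roots_of_unity_def t s del: power_Suc)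
qed

lemma word_mean_kernel_in_closure:
  assumes "norm z = 1" "z \<noteq> 1"
  shows "word_mean v (cauchy_kernel z) \<in> closure (insert 1 C_star)"
proof -
  have "continuous_on (sphere 0 1 - {1}) (\<lambda>z. word_mean v (cauchy_kernel z))"
    by (intro continuous_on_word_mean_param continuous_on_cauchy_kernel_param) auto
  moreover have zS: "z \<in> sphere 0 1 - {1}" using assms by simp
  ultimately have *: "\<exists>d>0. \<forall>u\<in>sphere 0 1 - {1}. dist u z < d \<longrightarrow>
      dist (word_mean v (cauchy_kernel u)) (word_mean v (cauchy_kernel z)) < e" if "e > 0" for e
    using that unfolding continuous_on_iff by blast
  show ?thesis
    unfolding closure_approachable
  proof (intro allI impI)
    fix e :: real assume "e > 0"
    from *[OF this] obtain d where d: "d > 0" "\<forall>u\<in>sphere 0 1 - {1}. dist u z < d \<longrightarrow>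
      dist (word_mean v (cauchy_kernel u)) (word_mean v (cauchy_kernel z)) < e" by blast
    \<comment> \<open>The second bound keeps \<open>u\<close> away from 1, where the kernel is
      singular.\<close>
    obtain N u where u: "N \<ge> 1" "u \<in> roots_of_unity N" "dist u z < min d (dist 1 z)"
      using roots_of_unity_dense[OF assms(1), of "min d (dist 1 z)"] d(1) assms(2)
      by (metis min_less_iff_conj zero_less_dist_iff)
    then have "u \<noteq> 1" by auto
    then have "u \<in> sphere 0 1 - {1}" using norm_root_of_unity[OF u(2,1)] by simp
    then have "dist (word_mean v (cauchy_kernel u)) (word_mean v (cauchy_kernel z)) < e"
      using d(2) u(3) by simp
    then show "\<exists>y\<in>insert 1 C_star. dist y (word_mean v (cauchy_kernel z)) < e"
      using word_mean_kernel_in_C_star[OF u(1,2) \<open>u \<noteq> 1\<close>, of v] by auto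
  qed
qed


section \<open>Behaviour near 1\<close>

lemma cauchy_kernel_Im:
  "Im (cauchy_kernel z x) = x * Im z / (norm (1 - z * of_real x))\<^sup>2"
  by (simp add: cauchy_kernel_def Im_divide cmod_power2)

text \<open>Here \<open>\<sigma>\<close> is a sign of \<open>Im z\<close>, so both half planes are
  treated at once. The upper bound combines \<open>\<sigma> * Im z \<le> norm (1 - z)\<close> with
  the lower bound for the denominator, whose factor 3 is squared.\<close>

lemma cauchy_kernel_Im_bounds:
  assumes "norm z \<le> 1" "z \<noteq> 1" "x \<in> {0..1}" "\<bar>\<sigma>\<bar> = 1" "0 \<le> \<sigma> * Im z"
  shows "0 \<le> \<sigma> * Im (cauchy_kernel z x)"
    and "\<sigma> * Im (cauchy_kernel z x) \<le> 9 * norm (1 - z) / (norm (1 - z) + (1 - x))\<^sup>2"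
proof -
  define d where "d = norm (1 - z)"
  have d: "d > 0" using assms by (simp add: d_def)
  have n: "norm (1 - z * of_real x) > 0" using one_minus_mult_nonzero[OF assms(1-3)] by simp
  have eq: "\<sigma> * Im (cauchy_kernel z x) = x * (\<sigma> * Im z) / (norm (1 - z * of_real x))\<^sup>2"
    by (simp add: cauchy_kernel_Im)
  show "0 \<le> \<sigma> * Im (cauchy_kernel z x)"
    unfolding eq using assms by (intro divide_nonneg_nonneg mult_nonneg_nonneg[of x]) auto
  have "\<bar>Im (1 - z)\<bar> \<le> d" unfolding d_def by (rule abs_Im_le_cmod)
  moreover have "\<sigma> * Im z \<le> \<bar>\<sigma>\<bar> * \<bar>Im z\<bar>" by (simp flip: abs_mult)
  ultimately have "\<sigma> * Im z \<le> d" using assms(4) by simp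
  then have "x * (\<sigma> * Im z) \<le> 1 * d"
    using assms by (intro mult_mono) auto
  then have "x * (\<sigma> * Im z) / (norm (1 - z * of_real x))\<^sup>2 \<le> d / (norm (1 - z * of_real x))\<^sup>2"
    by (intro divide_right_mono) auto
  also have "\<dots> \<le> d / ((d + (1 - x)) / 3)\<^sup>2"
  proof (rule divide_left_mono)
    show "((d + (1 - x)) / 3)\<^sup>2 \<le> (norm (1 - z * of_real x))\<^sup>2"
      using norm_one_minus_mult_ge[OF assms(1,3)] d assms(3)
      by (intro power_mono) (auto simp: d_def)
    have "d + (1 - x) > 0" using d assms(3) by simp
    then show "0 < (norm (1 - z * of_real x))\<^sup>2 * ((d + (1 - x)) / 3)\<^sup>2"
      using n by (intro mult_pos_pos zero_less_power) simp_all
  qed (use d in simp)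
  also have "\<dots> = 9 * d / (d + (1 - x))\<^sup>2"
    by (simp add: power_divide)
  finally show "\<sigma> * Im (cauchy_kernel z x) \<le> 9 * norm (1 - z) / (norm (1 - z) + (1 - x))\<^sup>2"
    unfolding eq d_def .
qed

text \<open>
  The kernel takes values in a quadrant of the plane, so a single linear functional controls its
  modulus; this is what makes the lower bound survive averaging.
\<close>

lemma Re_Complex_cauchy_kernel_ge:
  assumes "norm z \<le> 1" "z \<noteq> 1" "x \<in> {0..1}" "\<bar>\<sigma>\<bar> = 1" "0 \<le> \<sigma> * Im z"
  shows "1 / (norm (1 - z) + (1 - x)) \<le> Re (Complex 1 (- \<sigma>) * cauchy_kernel z x)"
proof -
  define k where "k = cauchy_kernel z x"
  have n: "norm (1 - z * of_real x) > 0" using one_minus_mult_nonzero[OF assms(1-3)] by simp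
  have "1 / (norm (1 - z) + (1 - x)) \<le> 1 / norm (1 - z * of_real x)"
    using n norm_one_minus_mult_le[OF assms(1,3)]
    by (intro divide_left_mono mult_pos_pos; linarith)
  also have "\<dots> = norm k" by (simp add: k_def cauchy_kernel_def norm_divide)
  also have "\<dots> \<le> \<bar>Re k\<bar> + \<bar>Im k\<bar>" by (rule cmod_le)
  also have "\<bar>Re k\<bar> = Re k"
  proof -
    have "1/2 + 1/8 * (1 - x) \<le> Re k" unfolding k_def by (rule Re_cauchy_kernel_ge[OF assms(1-3)])
    moreover have "0 \<le> 1/8 * (1 - x)" using assms(3) by simp
    ultimately have "0 \<le> Re k" by linarith
    then show ?thesis by simp
  qed
  also have "\<bar>Im k\<bar> = \<sigma> * Im k"
    using cauchy_kernel_Im_bounds(1)[OF assms] assms(4) unfolding k_def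
    by (metis abs_mult abs_of_nonneg mult_1)
  finally show ?thesis by (simp add: k_def)
qed

lemma integral_inverse_shift:
  assumes "a > 0"
  shows "((\<lambda>t. 1 / (a + t)) has_integral ln (1 + 1 / a)) {0..1::real}"
proof -
  have "((\<lambda>t. 1 / (a + t)) has_integral (ln (a + 1) - ln (a + 0))) {0..1}"
    using assms by (intro fundamental_theorem_of_calculus)
      (auto intro!: derivative_eq_intros simp flip: has_real_derivative_iff_has_vector_derivative)
  also have "ln (a + 1) - ln (a + 0) = ln ((a + 1) / a)"
    using assms by (simp add: ln_div)
  also have "(a + 1) / a = 1 + 1 / a" using assms by (simp add: field_simps)
  finally show ?thesis .
qed

lemma integral_inverse_shift_reflect:
  assumes "a > 0"
  shows "((\<lambda>t. 1 / (a + (1 - t))) has_integral ln (1 + 1 / a)) {0..1::real}"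
proof -
  have "((\<lambda>t. 1 / (a + (1 - t))) has_integral (- ln (a + (1 - 1)) - - ln (a + (1 - 0)))) {0..1}"
    using assms by (intro fundamental_theorem_of_calculus)
      (auto intro!: derivative_eq_intros simp flip: has_real_derivative_iff_has_vector_derivative)
  also have "- ln (a + (1 - 1)) - - ln (a + (1 - 0)) = ln ((a + 1) / a)"
    using assms by (simp add: ln_div)
  also have "(a + 1) / a = 1 + 1 / a" using assms by (simp add: field_simps)
  finally show ?thesis .
qed

lemma Re_seg_mean_ge_integral:
  assumes "continuous_on {0..1} f" "x \<in> {0..1}" "(g has_integral I) {0..1}"
    and "\<And>t. t \<in> {0..1} \<Longrightarrow> g t \<le> Re (f ((1 - t) * x + t * of_bool b))"
  shows "I \<le> Re (seg_mean b f x)"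
proof -
  have "continuous_on {0..1} (\<lambda>x. Re (f x))"
    using assms by (intro continuous_intros)
  then have "(\<lambda>t. Re (f ((1 - t) * x + t * of_bool b))) integrable_on {0..1}"
    by (rule integrable_seg[where f = "\<lambda>x. Re (f x)", OF _ assms(2)])
  then show ?thesis
    unfolding Re_seg_mean[OF assms(1,2)]
    by (intro has_integral_le[OF assms(3) integrable_integral] assms(4))
qed

lemma Re_seg_mean_le_integral:
  assumes "continuous_on {0..1} f" "x \<in> {0..1}" "(g has_integral I) {0..1}"
    and "\<And>t. t \<in> {0..1} \<Longrightarrow> Re (f ((1 - t) * x + t * of_bool b)) \<le> g t"
  shows "Re (seg_mean b f x) \<le> I"
proof -
  have "continuous_on {0..1} (\<lambda>x. Re (f x))"
    using assms by (intro continuous_intros)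
  then have "(\<lambda>t. Re (f ((1 - t) * x + t * of_bool b))) integrable_on {0..1}"
    by (rule integrable_seg[where f = "\<lambda>x. Re (f x)", OF _ assms(2)])
  then show ?thesis
    unfolding Re_seg_mean[OF assms(1,2)]
    by (intro has_integral_le[OF integrable_integral assms(3)] assms(4))
qed

text \<open>The integral of \<open>1 / (a + t)\<close> over \<open>{0..1}\<close> at
  \<open>a = d + sqrt d\<close>; it grows like half of \<open>ln (1 / d)\<close> as \<open>d\<close>
  tends to 0. The summand \<open>sqrt d\<close> is the threshold separating points near 1 from the
  others.\<close>

definition log_scale :: "real \<Rightarrow> real" where
  "log_scale d = ln (1 + 1 / (d + sqrt d))"

lemma log_scale_pos: "d > 0 \<Longrightarrow> log_scale d > 0"
  unfolding log_scale_def by (intro ln_gt_zero) (simp add: add_pos_pos)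

text \<open>The functional \<open>Re (Complex 1 (- \<sigma>) * w)\<close> is
  \<open>Re w + \<sigma> * Im w\<close>. When \<open>True\<close> is applied last, the final point
  is within \<open>1 - t\<close> of 1 whatever the earlier letters did, so the value is
  logarithmically large.\<close>

lemma word_mean_True_lower_bound:
  assumes "norm z \<le> 1" "z \<noteq> 1" "\<bar>\<sigma>\<bar> = 1" "0 \<le> \<sigma> * Im z"
  shows "log_scale (norm (1 - z)) \<le> Re (Complex 1 (- \<sigma>) * word_mean (True # v) (cauchy_kernel z))"
proof -
  define d where "d = norm (1 - z)"
  have d: "d > 0" using assms by (simp add: d_def)
  let ?f = "\<lambda>x. Complex 1 (- \<sigma>) * cauchy_kernel z x"
  have cf: "continuous_on {0..1} ?f"
    by (intro continuous_intros continuous_on_cauchy_kernel assms)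
  have "ln (1 + 1 / d) \<le> Re (seg_mean True ?f x)" if x: "x \<in> {0..1}" for x
  proof (rule Re_seg_mean_ge_integral[OF cf x])
    show "((\<lambda>t. 1 / (d + (1 - t))) has_integral ln (1 + 1 / d)) {0..1}"
      by (rule integral_inverse_shift_reflect[OF d])
    fix t :: real assume t: "t \<in> {0..1}"
    have "(1 - t) * (1 - x) \<le> 1 - t" using t x by (intro mult_left_le) auto
    moreover have "1 - ((1 - t) * x + t * of_bool True) = (1 - t) * (1 - x)"
      by (simp add: algebra_simps)
    ultimately have le: "1 - ((1 - t) * x + t * of_bool True) \<le> 1 - t" by simp
    have "0 \<le> 1 - ((1 - t) * x + t * of_bool True)"
      using seg_in_unit[OF x t, of True] by simp
    then have "1 / (d + (1 - t)) \<le> 1 / (d + (1 - ((1 - t) * x + t * of_bool True)))"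
      using le d t by (intro divide_left_mono mult_pos_pos add_pos_nonneg) auto
    also have "\<dots> \<le> Re (?f ((1 - t) * x + t * of_bool True))"
      unfolding d_def by (intro Re_Complex_cauchy_kernel_ge assms seg_in_unit x t)
    finally show "1 / (d + (1 - t)) \<le> Re (?f ((1 - t) * x + t * of_bool True))" .
  qed
  then have "Re (word_mean v (\<lambda>_. of_real (ln (1 + 1 / d)))) \<le> Re (word_mean v (seg_mean True ?f))"
    by (intro Re_word_mean_mono continuous_on_seg_mean cf) auto
  then have "ln (1 + 1 / d) \<le> Re (word_mean (True # v) ?f)" by simp
  moreover have "log_scale d \<le> ln (1 + 1 / d)"
    unfolding log_scale_def using d
    by (subst ln_le_cancel_iff) (auto intro!: divide_left_mono mult_pos_pos add_pos_pos)
  ultimately show ?thesis unfolding word_mean_cmult d_def by simp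
qed

text \<open>Let \<open>x\<close> be the point before the last letter. If
  \<open>1 - x \<le> sqrt d\<close>, the averaged imaginary part is at most 9 while the averaged
  functional is at least \<open>log_scale d\<close>; otherwise the imaginary part is at most
  \<open>9 * sqrt d\<close>. The sum of the two bounds covers both cases and can be averaged over
  the remaining word.\<close>

lemma word_mean_False_Im_bound:
  assumes "norm z \<le> 1" "z \<noteq> 1" "\<bar>\<sigma>\<bar> = 1" "0 \<le> \<sigma> * Im z"
  defines "d \<equiv> norm (1 - z)"
  shows "\<sigma> * Im (word_mean (False # v) (cauchy_kernel z))
    \<le> 9 * sqrt d + 9 / log_scale d * Re (Complex 1 (- \<sigma>) * word_mean (False # v) (cauchy_kernel z))"
proof -
  have d: "d > 0" using assms by (simp add: d_def)
  have l: "log_scale d > 0" using d by (rule log_scale_pos)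
  let ?f = "\<lambda>x. Complex 1 (- \<sigma>) * cauchy_kernel z x"
  \<comment> \<open>The real part of \<open>?g\<close> is \<open>\<sigma>\<close> times the
    imaginary part of the kernel.\<close>
  let ?g = "\<lambda>x. Complex 0 (- \<sigma>) * cauchy_kernel z x"
  have cf: "continuous_on {0..1} ?f" and cg: "continuous_on {0..1} ?g"
    by (intro continuous_intros continuous_on_cauchy_kernel assms)+
  have g_le: "Re (seg_mean False ?g x) \<le> 9 * (d / (d + (1 - x)))" if x: "x \<in> {0..1}" for x
  proof -
    have pos: "d + (1 - (1 - t) * x) > 0" if "t \<in> {0..1}" for t
      using seg_in_unit[OF x that, of False] d by simp
    have "Re (seg_mean False ?g x) \<le> 9 * d / ((d + 1) * (d + (1 - x)))"
    proof (rule Re_seg_mean_le_integral[OF cg x])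
      \<comment> \<open>The quotient in \<open>?F\<close> has derivative \<open>- (d + 1)\<close>
        over the squared denominator; \<open>c\<close> rescales this to
        \<open>9 * d\<close>.\<close>
      define c where "c = - (9 * d / (d + 1))"
      have c: "c * - (d + 1) = 9 * d" using d by (simp add: c_def field_simps)
      let ?F = "\<lambda>t. c * ((1 - t) / (d + (1 - (1 - t) * x)))"
      have "(?F has_real_derivative 9 * d / (d + (1 - (1 - t) * x))\<^sup>2) (at t within {0..1})"
        if "t \<in> {0..1}" for t
      proof -
        have "((\<lambda>t. (1 - t) / (d + (1 - (1 - t) * x))) has_real_derivative
            ((- 1) * (d + (1 - (1 - t) * x)) - (1 - t) * x) / ((d + (1 - (1 - t) * x)) * (d + (1 - (1 - t) * x))))
            (at t within {0..1})"
          using pos[OF that] by (intro derivative_eq_intros | simp)+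
        also have "(- 1) * (d + (1 - (1 - t) * x)) - (1 - t) * x = - (d + 1)" by (simp add: algebra_simps)
        finally have D: "((\<lambda>t. (1 - t) / (d + (1 - (1 - t) * x))) has_real_derivative
            - (d + 1) / (d + (1 - (1 - t) * x))\<^sup>2) (at t within {0..1})"
          by (simp only: power2_eq_square)
        show ?thesis
          using DERIV_cmult[OF D, of c] unfolding times_divide_eq_right c .
      qed
      then have "((\<lambda>t. 9 * d / (d + (1 - (1 - t) * x))\<^sup>2) has_integral ?F 1 - ?F 0) {0..1}"
        by (intro fundamental_theorem_of_calculus)
          (simp_all flip: has_real_derivative_iff_has_vector_derivative)
      then show "((\<lambda>t. 9 * d / (d + (1 - (1 - t) * x))\<^sup>2) has_integral 9 * d / ((d + 1) * (d + (1 - x)))) {0..1}"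
        by (simp add: c_def)
      fix t :: real assume t: "t \<in> {0..1}"
      show "Re (?g ((1 - t) * x + t * of_bool False)) \<le> 9 * d / (d + (1 - (1 - t) * x))\<^sup>2"
        using cauchy_kernel_Im_bounds(2)[OF assms(1,2) seg_in_unit[OF x t, of False] assms(3,4)]
        by (simp add: d_def)
    qed
    also have "\<dots> \<le> 9 * d / (1 * (d + (1 - x)))"
      using d x by (intro divide_left_mono mult_right_mono mult_pos_pos add_pos_nonneg) auto
    finally show ?thesis by simp
  qed
  have f_nonneg: "0 \<le> Re (seg_mean False ?f x)" if x: "x \<in> {0..1}" for x
  proof (rule Re_seg_mean_ge_integral[OF cf x has_integral_0])
    fix t :: real assume t: "t \<in> {0..1}"
    have "0 \<le> 1 / (norm (1 - z) + (1 - ((1 - t) * x + t * of_bool False)))"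
      using seg_in_unit[OF x t, of False] by (intro divide_nonneg_nonneg add_nonneg_nonneg) auto
    also have "\<dots> \<le> Re (?f ((1 - t) * x + t * of_bool False))"
      by (intro Re_Complex_cauchy_kernel_ge assms seg_in_unit x t)
    finally show "0 \<le> Re (?f ((1 - t) * x + t * of_bool False))" .
  qed
  have f_ge: "log_scale d \<le> Re (seg_mean False ?f x)" if x: "x \<in> {0..1}" "1 - x \<le> sqrt d" for x
    unfolding log_scale_def
  proof (rule Re_seg_mean_ge_integral[OF cf x(1) integral_inverse_shift])
    fix t :: real assume t: "t \<in> {0..1}"
    have "t * x \<le> t" using t x by (intro mult_left_le) auto
    then have le: "1 - ((1 - t) * x + t * of_bool False) \<le> sqrt d + t"
      using x(2) by (simp add: algebra_simps)
    have "0 \<le> 1 - ((1 - t) * x + t * of_bool False)"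
      using seg_in_unit[OF x(1) t, of False] by simp
    then have "1 / (d + sqrt d + t) \<le> 1 / (d + (1 - ((1 - t) * x + t * of_bool False)))"
      using le d t by (intro divide_left_mono mult_pos_pos add_pos_nonneg) auto
    also have "\<dots> \<le> Re (?f ((1 - t) * x + t * of_bool False))"
      unfolding d_def by (intro Re_Complex_cauchy_kernel_ge assms seg_in_unit x t)
    finally show "1 / (d + sqrt d + t) \<le> Re (?f ((1 - t) * x + t * of_bool False))" .
  qed (use d in \<open>simp add: add_pos_pos\<close>)
  have key: "Re (seg_mean False ?g x)
      \<le> Re (of_real (9 * sqrt d) + of_real (9 / log_scale d) * seg_mean False ?f x)"
    if x: "x \<in> {0..1}" for x
  proof -
    have eq: "Re (of_real (9 * sqrt d) + of_real (9 / log_scale d) * s) = 9 * sqrt d + 9 * (1 / log_scale d * Re s)" for s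
      by simp
    show ?thesis
    proof (cases "1 - x \<le> sqrt d")
      case True
      have "d / (d + (1 - x)) \<le> 1" using d x by simp
      moreover have "1 \<le> 1 / log_scale d * Re (seg_mean False ?f x)"
        using f_ge[OF x True] l by simp
      moreover have "0 \<le> sqrt d" using d by simp
      ultimately show ?thesis using g_le[OF x] unfolding eq by linarith
    next
      case False
      have "d / (d + (1 - x)) \<le> d / sqrt d"
        using False d x by (intro divide_left_mono mult_pos_pos) (auto simp: add_pos_nonneg)
      also have "\<dots> = sqrt d" using d by (simp add: real_div_sqrt)
      finally have "d / (d + (1 - x)) \<le> sqrt d" .
      moreover have "0 \<le> 1 / log_scale d * Re (seg_mean False ?f x)"
        using f_nonneg[OF x] l by simp
      ultimately show ?thesis using g_le[OF x] unfolding eq by linarith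
    qed
  qed
  have cont: "continuous_on {0..1} (\<lambda>x. of_real (9 / log_scale d) * seg_mean False ?f x)"
    by (intro continuous_intros continuous_on_seg_mean[OF cf])
  have "Re (word_mean v (seg_mean False ?g))
      \<le> Re (word_mean v (\<lambda>x. of_real (9 * sqrt d) + of_real (9 / log_scale d) * seg_mean False ?f x))"
    by (intro Re_word_mean_mono key continuous_on_seg_mean[OF cg] continuous_on_add cont continuous_on_const)
  also have "\<dots> = 9 * sqrt d + 9 / log_scale d * Re (word_mean (False # v) ?f)"
  proof -
    have eq: "Re (of_real a + of_real b * s) = a + b * Re s" for a b s by simp
    show ?thesis
      unfolding word_mean_add[OF continuous_on_const cont] word_mean_const
        word_mean_cmult[of v "of_real (9 / log_scale d)"] eq
      by (simp only: word_mean.simps)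
  qed
  finally have "Re (word_mean (False # v) ?g) \<le> 9 * sqrt d + 9 / log_scale d * Re (word_mean (False # v) ?f)"
    by simp
  then show ?thesis unfolding word_mean_cmult by simp
qed

lemma word_mean_Im_nonneg:
  assumes "norm z \<le> 1" "z \<noteq> 1" "\<bar>\<sigma>\<bar> = 1" "0 \<le> \<sigma> * Im z"
  shows "0 \<le> \<sigma> * Im (word_mean v (cauchy_kernel z))"
proof -
  have "Re (word_mean v (\<lambda>_. 0)) \<le> Re (word_mean v (\<lambda>x. Complex 0 (- \<sigma>) * cauchy_kernel z x))"
    using cauchy_kernel_Im_bounds(1)[OF assms(1,2) _ assms(3,4)]
    by (intro Re_word_mean_mono continuous_intros continuous_on_cauchy_kernel assms) simp
  then show ?thesis unfolding word_mean_cmult by simp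
qed

lemma log_scale_at_top: "filterlim log_scale at_top (at_right 0)"
proof -
  have "((\<lambda>d::real. d + sqrt d) \<longlongrightarrow> 0 + sqrt 0) (at_right 0)"
    by (intro tendsto_intros)
  moreover have "\<forall>\<^sub>F d in at_right 0. 0 < d + sqrt (d::real)"
    using eventually_at_right_less[of 0] by eventually_elim (simp add: add_pos_pos)
  ultimately have "filterlim (\<lambda>d::real. inverse (d + sqrt d)) at_top (at_right 0)"
    by (intro filterlim_inverse_at_top) simp_all
  then have "filterlim (\<lambda>d::real. 1 + inverse (d + sqrt d)) at_top (at_right 0)"
    by (intro filterlim_tendsto_add_at_top[OF tendsto_const])
  then show ?thesis
    unfolding log_scale_def by (intro filterlim_compose[OF ln_at_top]) (simp add: inverse_eq_divide)
qed

lemma word_mean_near_1: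
  assumes "\<eta> > 0" "M > 0"
  obtains d0 where "d0 > 0"
    "\<And>z v. norm z \<le> 1 \<Longrightarrow> 0 < norm (1 - z) \<Longrightarrow> norm (1 - z) < d0 \<Longrightarrow>
      \<bar>Re (word_mean v (cauchy_kernel z))\<bar> + \<bar>Im (word_mean v (cauchy_kernel z))\<bar> \<le> M \<Longrightarrow>
      \<bar>Im (word_mean v (cauchy_kernel z))\<bar> < \<eta>"
proof -
  \<comment> \<open>Exceeding \<open>M\<close> excludes words starting with \<open>True\<close>. For
    words starting with \<open>False\<close>, exceeding \<open>18 * M / \<eta>\<close> leaves less
    than \<open>\<eta> / 2\<close> for the second summand of the imaginary bound, and the first is
    below \<open>\<eta> / 2\<close> as well. The threshold \<open>d0\<close> is the same for all
    words.\<close>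
  have "\<forall>\<^sub>F d in at_right 0. log_scale d > max M (18 * M / \<eta>)"
    using log_scale_at_top unfolding filterlim_at_top_dense by blast
  moreover have "((\<lambda>d::real. 9 * sqrt d) \<longlongrightarrow> 9 * sqrt 0) (at_right 0)"
    by (intro tendsto_intros)
  then have "\<forall>\<^sub>F d in at_right 0. 9 * sqrt (d::real) < \<eta> / 2"
    using assms(1) by (intro order_tendstoD(2)) auto
  ultimately have "\<forall>\<^sub>F d in at_right 0. log_scale d > max M (18 * M / \<eta>) \<and> 9 * sqrt d < \<eta> / 2"
    by (rule eventually_conj)
  then obtain d0 where d0: "d0 > 0"
    "\<And>d. 0 < d \<Longrightarrow> d < d0 \<Longrightarrow> log_scale d > max M (18 * M / \<eta>) \<and> 9 * sqrt d < \<eta> / 2"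
    unfolding eventually_at_right_field by auto
  show ?thesis
  proof (rule that[OF d0(1)])
    fix z v
    assume z: "norm z \<le> 1" "0 < norm (1 - z)" "norm (1 - z) < d0"
      and M: "\<bar>Re (word_mean v (cauchy_kernel z))\<bar> + \<bar>Im (word_mean v (cauchy_kernel z))\<bar> \<le> M"
    define d where "d = norm (1 - z)"
    define w where "w = word_mean v (cauchy_kernel z)"
    have z1: "z \<noteq> 1" using z(2) by auto
    define \<sigma> :: real where "\<sigma> = (if Im z \<ge> 0 then 1 else -1)"
    have \<sigma>: "\<bar>\<sigma>\<bar> = 1" "0 \<le> \<sigma> * Im z" by (auto simp: \<sigma>_def)
    have l: "log_scale d > M" "log_scale d > 18 * M / \<eta>" and sq: "9 * sqrt d < \<eta> / 2"
      using d0(2)[of d] z by (auto simp: d_def)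
    have abs_Im: "\<bar>Im w\<bar> = \<sigma> * Im w"
      using word_mean_Im_nonneg[OF z(1) z1 \<sigma>, of v] \<sigma>(1) unfolding w_def
      by (metis abs_mult abs_of_nonneg mult_1)
    have Re_le: "Re (Complex 1 (- \<sigma>) * w) \<le> M"
      using M abs_Im by (simp add: w_def)
    show "\<bar>Im (word_mean v (cauchy_kernel z))\<bar> < \<eta>"
    proof (cases v)
      case Nil
      then show ?thesis using assms(1) by (simp add: cauchy_kernel_def)
    next
      case (Cons b u)
      show ?thesis
      proof (cases b)
        case True
        then have "log_scale d \<le> M"
          using word_mean_True_lower_bound[OF z(1) z1 \<sigma>, of u] Re_le Cons by (simp add: d_def w_def)
        then show ?thesis using l by simp
      next
        case False
        have "\<sigma> * Im w \<le> 9 * sqrt d + 9 / log_scale d * Re (Complex 1 (- \<sigma>) * w)"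
          using word_mean_False_Im_bound[OF z(1) z1 \<sigma>, of u] False Cons by (simp add: d_def w_def)
        also have "\<dots> \<le> 9 * sqrt d + 9 / log_scale d * M"
          using l assms(2) Re_le by (intro add_left_mono mult_left_mono) auto
        also have "9 / log_scale d * M < \<eta> / 2"
          using l assms by (simp add: field_simps)
        finally show ?thesis using sq abs_Im by (simp add: w_def)
      qed
    qed
  qed
qed


section \<open>Density\<close>

text \<open>A continuous logarithm makes the Borsuk map of \<open>\<zeta>\<close> on the frontier
  inessential, so \<open>\<zeta>\<close> would lie in an unbounded component of the complement of
  the frontier. But the component of an interior point cannot leave the bounded set
  \<open>X\<close>.\<close>

lemma no_continuous_log_translate:
  fixes X :: "complex set"
  assumes "bounded X" "\<zeta> \<in> interior X"
  shows "\<not> (\<exists>h. continuous_on (frontier X) h \<and> (\<forall>z\<in>frontier X. z - \<zeta> = exp (h z)))"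
proof
  assume "\<exists>h. continuous_on (frontier X) h \<and> (\<forall>z\<in>frontier X. z - \<zeta> = exp (h z))"
  then obtain h where h: "continuous_on (frontier X) h" "\<And>z. z \<in> frontier X \<Longrightarrow> z - \<zeta> = exp (h z)"
    by blast
  have \<zeta>: "\<zeta> \<notin> frontier X" using assms(2) by (simp add: frontier_def)
  define f where "f = (\<lambda>z. inverse (norm (z - \<zeta>)) *\<^sub>R (z - \<zeta>))"
  have "f z = exp (\<i> * of_real (Im (h z)))" if "z \<in> frontier X" for z
  proof -
    have "f z = of_real (inverse (exp (Re (h z)))) * exp (h z)"
      unfolding f_def h(2)[OF that] scaleR_conv_of_real by simp
    also have "exp (h z) = exp (of_real (Re (h z)) + \<i> * of_real (Im (h z)))"
      by (simp flip: complex_eq)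
    also have "\<dots> = of_real (exp (Re (h z))) * exp (\<i> * of_real (Im (h z)))"
      by (simp only: exp_add exp_of_real)
    finally show ?thesis by (simp flip: of_real_mult mult.assoc)
  qed
  moreover have "continuous_on (frontier X) (\<lambda>z. Im (h z))"
    by (intro continuous_intros h)
  ultimately have "\<exists>c. homotopic_with_canon (\<lambda>_. True) (frontier X) (sphere 0 1) f (\<lambda>_. c)"
    unfolding inessential_eq_continuous_logarithm_circle by blast
  then have unb: "\<not> bounded (connected_component_set (- frontier X) \<zeta>)"
    using Borsuk_map_essential_bounded_component[OF compact_frontier_bounded[OF assms(1)] \<zeta>]
    unfolding f_def by blast
  let ?C = "connected_component_set (- frontier X) \<zeta>"
  have "\<zeta> \<in> ?C" using \<zeta> by (simp add: connected_component_refl)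
  moreover have "\<zeta> \<in> X" using assms(2) interior_subset by blast
  moreover have "?C \<inter> frontier X = {}" using connected_component_subset by blast
  ultimately have "?C \<subseteq> X"
    using connected_Int_frontier[OF connected_connected_component, of "- frontier X" \<zeta> X] by blast
  then show False using unb assms(1) bounded_subset by blast
qed

lemma off_axis_in_closure_C_star:
  assumes "w \<in> open_half_plane" "Im w \<noteq> 0"
  shows "w \<in> closure C_star"
proof (rule ccontr)
  assume nw: "w \<notin> closure C_star"
  have w1: "w \<noteq> 1" and w0: "w \<noteq> 0" using assms(2) by auto
  have "open (- closure (insert 1 C_star))" by (simp add: open_Compl)
  moreover have "w \<in> - closure (insert 1 C_star)"
    using nw w1 by (simp add: closure_insert)
  ultimately obtain \<epsilon> where \<epsilon>: "\<epsilon> > 0" "ball w \<epsilon> \<subseteq> - closure (insert 1 C_star)"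
    unfolding open_contains_ball by blast
  \<comment> \<open>Any value within \<open>\<eta>\<close> of \<open>w\<close> has imaginary part
    larger than \<open>\<eta>\<close> in modulus and satisfies the size bound \<open>M\<close>,
    contrary to the estimate near 1.\<close>
  define \<eta> where "\<eta> = \<bar>Im w\<bar> / 2"
  have \<eta>: "\<eta> > 0" using assms(2) by (simp add: \<eta>_def)
  define M where "M = \<bar>Re w\<bar> + \<bar>Im w\<bar> + 2 * \<eta>"
  have M: "M > 0" using \<eta> by (simp add: M_def)
  obtain d0 where d0: "d0 > 0"
    "\<And>z v. norm z \<le> 1 \<Longrightarrow> 0 < norm (1 - z) \<Longrightarrow> norm (1 - z) < d0 \<Longrightarrow>
      \<bar>Re (word_mean v (cauchy_kernel z))\<bar> + \<bar>Im (word_mean v (cauchy_kernel z))\<bar> \<le> M \<Longrightarrow>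
      \<bar>Im (word_mean v (cauchy_kernel z))\<bar> < \<eta>"
    using word_mean_near_1[OF \<eta> M] by blast
  \<comment> \<open>Below \<open>d0\<close> for the estimate near 1, and below
    \<open>inverse (norm w)\<close>, the distance from 1 to \<open>1 - 1 / w\<close>, so that this
    point survives the removal of the ball.\<close>
  define d where "d = min d0 (inverse (norm w)) / 2"
  have d: "d > 0" "d < d0" "d < inverse (norm w)"
    using d0(1) w0 by (auto simp: d_def min_def field_simps)
  define X where "X = cball (0::complex) 1 - ball 1 d"
  define S where "S = frontier X"
  have clX: "closed X" unfolding X_def by (intro closed_Diff) auto
  have op: "open (ball (0::complex) 1 \<inter> - cball 1 d)" by (intro open_Int open_Compl) auto
  have intX: "ball 0 1 \<inter> - cball 1 d \<subseteq> interior X"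
    by (rule interior_maximal[OF _ op]) (auto simp: X_def)
  have S: "norm z \<le> 1" "d \<le> norm (1 - z)" "norm z = 1 \<or> norm (1 - z) = d" if "z \<in> S" for z
  proof -
    have z: "z \<in> X" "z \<notin> interior X"
      using that clX unfolding S_def frontier_def by auto
    then show "norm z \<le> 1" "d \<le> norm (1 - z)" by (auto simp: X_def dist_norm)
    then show "norm z = 1 \<or> norm (1 - z) = d"
      using z(2) intX by (force simp: dist_norm)
  qed
  have z1: "z \<noteq> 1" if "z \<in> S" for z using S(2)[OF that] d(1) by auto
  define \<delta> where "\<delta> = min \<epsilon> \<eta>"
  have \<delta>: "\<delta> > 0" using \<epsilon> \<eta> by (simp add: \<delta>_def)
  have far: "\<delta> \<le> norm (word_mean v (cauchy_kernel z) - w)" if z: "z \<in> S" for z v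
    using S(3)[OF z]
  proof
    assume "norm z = 1"
    then have "word_mean v (cauchy_kernel z) \<in> closure (insert 1 C_star)"
      by (rule word_mean_kernel_in_closure[OF _ z1[OF z]])
    then have "\<epsilon> \<le> dist w (word_mean v (cauchy_kernel z))"
      using \<epsilon>(2) by (meson ComplD mem_ball not_le subset_iff)
    then show ?thesis by (simp add: \<delta>_def dist_norm norm_minus_commute)
  next
    assume zd: "norm (1 - z) = d"
    define u where "u = word_mean v (cauchy_kernel z)"
    show ?thesis
    proof (rule ccontr)
      assume "\<not> \<delta> \<le> norm (word_mean v (cauchy_kernel z) - w)"
      then have lt: "norm (u - w) < \<eta>" by (simp add: \<delta>_def u_def)
      have re: "\<bar>Re u - Re w\<bar> < \<eta>" and im: "\<bar>Im u - Im w\<bar> < \<eta>"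
        using abs_Re_le_cmod[of "u - w"] abs_Im_le_cmod[of "u - w"] lt by auto
      then have "\<bar>Re u\<bar> + \<bar>Im u\<bar> \<le> M" unfolding M_def by linarith
      then have "\<bar>Im u\<bar> < \<eta>"
        unfolding u_def using S(1)[OF z] zd d by (intro d0(2)) auto
      then show False using im unfolding \<eta>_def by linarith
    qed
  qed
  define L where "L = 9 / d\<^sup>2"
  have L: "L > 0" using d by (simp add: L_def)
  obtain n where n: "L / 2 ^ n < \<delta>"
  proof -
    obtain n where "(1/2) ^ n < \<delta> / L" using real_arch_pow_inv[of "\<delta> / L" "1/2"] \<delta> L by auto
    then have "L / 2 ^ n < \<delta>" using L by (simp add: field_simps power_divide)
    then show ?thesis by (rule that)
  qed
  have cK: "continuous_on (S \<times> {0..1}) (\<lambda>(z, x). cauchy_kernel z x)"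
    using S(1) z1 by (intro continuous_on_cauchy_kernel_param) auto
  have "\<exists>h. continuous_on S h \<and> (\<forall>z\<in>S. cauchy_kernel z 1 - w = exp (h z))"
  proof (rule continuous_log_transfer[where f = "\<lambda>z x. cauchy_kernel z x - w" and L = L and n = n])
    show "continuous_on (S \<times> {0..1}) (\<lambda>(z, x). cauchy_kernel z x - w)"
      using continuous_on_diff[OF cK continuous_on_const[of _ w]] by (simp add: case_prod_unfold)
  next
    fix z x y assume z: "z \<in> S" and xy: "x \<in> {0..1::real}" "y \<in> {0..1::real}"
    have "norm (cauchy_kernel z x - cauchy_kernel z y) \<le> 9 / (norm (1 - z))\<^sup>2 * \<bar>x - y\<bar>"
      by (rule cauchy_kernel_lipschitz[OF S(1)[OF z] z1[OF z] xy])
    also have "9 / (norm (1 - z))\<^sup>2 \<le> L"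
      unfolding L_def using S(2)[OF z] d(1)
      by (intro divide_left_mono power_mono mult_pos_pos zero_less_power) auto
    finally show "norm (cauchy_kernel z x - w - (cauchy_kernel z y - w)) \<le> L * \<bar>x - y\<bar>"
      by (simp add: mult_right_mono)
  next
    fix z and v :: "bool list" assume z: "z \<in> S"
    have "word_mean v (\<lambda>x. cauchy_kernel z x - w) = word_mean v (cauchy_kernel z) - w"
      using word_mean_diff[OF continuous_on_cauchy_kernel[OF S(1)[OF z] z1[OF z]] continuous_on_const[of _ w]]
      by simp
    then show "L / 2 ^ n < norm (word_mean v (\<lambda>x. cauchy_kernel z x - w))"
      using far[OF z, of v] n by simp
  next
    show "\<exists>h. continuous_on S h \<and> (\<forall>z\<in>S. cauchy_kernel z 0 - w = exp (h z))"
      using w1 by (intro exI[of _ "\<lambda>_. Ln (1 - w)"]) (auto simp: cauchy_kernel_def)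
  qed
  then obtain h where h: "continuous_on S h" "\<And>z. z \<in> S \<Longrightarrow> cauchy_kernel z 1 - w = exp (h z)"
    by blast
  define \<zeta> where "\<zeta> = 1 - 1 / w"
  have \<zeta>1: "1 - \<zeta> = 1 / w" by (simp add: \<zeta>_def)
  \<comment> \<open>This puts \<open>1 - z\<close> in the domain where the principal logarithm is
    continuous.\<close>
  have Re_pos: "Re (1 - z) > 0" if "z \<in> S" for z
  proof -
    have "Re z \<noteq> 1"
    proof
      assume "Re z = 1"
      moreover have "(Re z)\<^sup>2 + (Im z)\<^sup>2 \<le> 1"
        using S(1)[OF that] by (simp flip: cmod_power2 add: power_le_one)
      ultimately show False using z1[OF that] by (simp add: complex_eq_iff)
    qed
    then show ?thesis using complex_Re_le_cmod[of z] S(1)[OF that] by simp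
  qed
  \<comment> \<open>Multiplying \<open>1 / (1 - z) - w\<close> by
    \<open>(1 - z) * (1 - \<zeta>)\<close>, where \<open>1 - \<zeta> = 1 / w\<close>, gives
    \<open>z - \<zeta>\<close>; hence the three logarithms are added.\<close>
  have "continuous_on S (\<lambda>z. h z + Ln (1 - z) + Ln (1 - \<zeta>))"
    using Re_pos by (intro continuous_intros h) (force simp: complex_nonpos_Reals_iff)
  moreover have "z - \<zeta> = exp (h z + Ln (1 - z) + Ln (1 - \<zeta>))" if "z \<in> S" for z
  proof -
    have "1 - z \<noteq> 0" "1 - \<zeta> \<noteq> 0" using z1[OF that] w0 \<zeta>1 by auto
    then have "exp (h z + Ln (1 - z) + Ln (1 - \<zeta>)) = (cauchy_kernel z 1 - w) * (1 - z) * (1 - \<zeta>)"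
      using h(2)[OF that] by (simp add: exp_add)
    also have "\<dots> = z - \<zeta>"
      unfolding \<zeta>1 unfolding \<zeta>_def using z1[OF that] w0
      by (simp add: cauchy_kernel_def field_simps)
    finally show ?thesis by simp
  qed
  moreover have "\<zeta> \<in> interior X"
  proof -
    \<comment> \<open>The condition \<open>Re w > 1/2\<close> says that \<open>w\<close> is closer
      to 1 than to 0, which is \<open>norm \<zeta> < 1\<close>.\<close>
    have "(norm (w - 1))\<^sup>2 < (norm w)\<^sup>2"
      using assms(1) unfolding cmod_power2 open_half_plane_def
      by (simp add: power2_eq_square algebra_simps)
    then have "norm (w - 1) < norm w" by (rule power_less_imp_less_base) simp
    moreover have "\<zeta> = (w - 1) / w" using w0 by (simp add: \<zeta>_def field_simps)
    ultimately have "norm \<zeta> < 1" using w0 by (simp add: norm_divide)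
    moreover have "norm (1 - \<zeta>) > d" using d(3) by (simp add: \<zeta>1 norm_divide inverse_eq_divide)
    ultimately show ?thesis using intX by (force simp: dist_norm)
  qed
  moreover have "bounded X" unfolding X_def by (rule bounded_subset[OF bounded_cball]) blast
  ultimately show False
    using no_continuous_log_translate[of X \<zeta>] unfolding S_def by blast
qed

section \<open>Accumulation points\<close>

lemma C_star_meets_punctured_nhds:
  assumes "p \<in> closed_half_plane" "open T" "p \<in> T"
  obtains y where "y \<in> C_star" "y \<in> T" "y \<noteq> p"
proof -
  obtain r where r: "r > 0" "ball p r \<subseteq> T" using assms unfolding open_contains_ball by blast
  \<comment> \<open>A nearby point off the real axis and strictly inside the half plane.
    Approximating it to within \<open>dist q p\<close> yields a point different from
    \<open>p\<close>, at distance less than \<open>r / 2\<close> from \<open>p\<close>.\<close>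
  define q where "q = Complex (Re p + r / 8) (if Im p = 0 then r / 8 else Im p)"
  have q: "q \<in> open_half_plane" "Im q \<noteq> 0" "q \<noteq> p"
    using assms(1) r by (auto simp: q_def open_half_plane_def closed_half_plane_def complex_eq_iff)
  have "norm (q - p) \<le> \<bar>Re (q - p)\<bar> + \<bar>Im (q - p)\<bar>" by (rule cmod_le)
  also have "\<dots> \<le> r / 4" using r by (auto simp: q_def)
  finally have qp: "dist q p \<le> r / 4" by (simp add: dist_norm)
  obtain y where y: "y \<in> C_star" "dist y q < dist q p"
    using off_axis_in_closure_C_star[OF q(1,2)] q(3) unfolding closure_approachable
    by (metis zero_less_dist_iff)
  have "dist y p < r" using dist_triangle[of y p q] y(2) qp r(1) by linarith
  then have "y \<in> T" using r(2) by (auto simp: dist_commute)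
  moreover have "y \<noteq> p" using y(2) by (auto simp: dist_commute)
  ultimately show ?thesis using y(1) that by blast
qed

text \<open>Stated for every set between \<open>C_star\<close> and the closed half plane, so that
  one argument serves the first derived set and, with \<open>E\<close> the half plane itself, all
  later ones.\<close>

lemma derived_set_eq_closed_half_plane:
  assumes "C_star \<subseteq> E" "E \<subseteq> closed_half_plane"
  shows "euclidean derived_set_of E = closed_half_plane"
proof
  have "closed closed_half_plane"
    unfolding closed_half_plane_def by (rule closed_halfspace_Re_ge)
  then have op: "openin euclidean (- closed_half_plane)" by (simp add: open_Compl)
  show "euclidean derived_set_of E \<subseteq> closed_half_plane"
  proof (rule subsetI, rule ccontr)
    fix p assume "p \<in> euclidean derived_set_of E" "p \<notin> closed_half_plane"
    then obtain y where "y \<in> E" "y \<in> - closed_half_plane"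
      using op unfolding in_derived_set_of by (metis ComplI)
    then show False using assms(2) by blast
  qed
  show "closed_half_plane \<subseteq> euclidean derived_set_of E"
  proof
    fix p assume p: "p \<in> closed_half_plane"
    show "p \<in> euclidean derived_set_of E"
      unfolding in_derived_set_of
    proof (intro conjI allI impI)
      fix T assume "p \<in> T \<and> openin euclidean T"
      then obtain y where "y \<in> C_star" "y \<in> T" "y \<noteq> p"
        using C_star_meets_punctured_nhds[OF p, of T] by (metis open_openin)
      then show "\<exists>y. y \<noteq> p \<and> y \<in> E \<and> y \<in> T" using assms(1) by blast
    qed simp
  qed
qed

theorem theorem1p4:
  shows "countable C_star \<and> C_star \<subseteq> open_half_plane \<and> open_half_plane \<subseteq> closure C_star
    \<and> (\<forall>n\<ge>1. iterated_derived_set n C_star = closed_half_plane)"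
proof (intro conjI allI impI)
  have sub: "open_half_plane \<subseteq> closed_half_plane"
    by (auto simp: open_half_plane_def closed_half_plane_def)
  show "open_half_plane \<subseteq> closure C_star"
  proof
    fix p assume "p \<in> open_half_plane"
    then have p: "p \<in> closed_half_plane" using sub by blast
    show "p \<in> closure C_star"
      unfolding closure_iff_nhds_not_empty
      using C_star_meets_punctured_nhds[OF p] by blast
  qed
  have C: "C_star \<subseteq> closed_half_plane" using C_star_subset_open_half_plane sub by blast
  show "iterated_derived_set n C_star = closed_half_plane" if "n \<ge> 1" for n
    using that
  proof (induction n rule: nat_induct_at_least)
    case base
    show ?case
      using derived_set_eq_closed_half_plane[OF subset_refl C] by (simp add: iterated_derived_set_def)
  next
    case (Suc n)
    then show ?case
      using derived_set_eq_closed_half_plane[OF C subset_refl] by (simp add: iterated_derived_set_def)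
  qed
qed (fact countable_C_star C_star_subset_open_half_plane)+

end
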